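(* Let $a,b,c\in\mathbb{R}$ with $a\neq 0$, $c\neq 0$, and let $(X,J_{a,b,c},\omega_{a,b,c})$ be the compact almost-Kähler solvmanifold described in the context. Then $h^{1,0}_{\overline{\partial}}=1$ (spanned by $\varphi^1$), $h^{2,0}_{\overline{\partial}}=0$ if $c\notin 4\pi\mathbb{Z}$ and $h^{2,0}_{\overline{\partial}}=2$ if $c\in 4\pi\mathbb{Z}$, and $h^{3,0}_{\overline{\partial}}=1$ (spanned by $\varphi^{1}\wedge\varphi^2\wedge\varphi^3$).
   Context: General notions. For an almost-complex manifold $(X,J)$ of real dimension $2n$, complex differential forms decompose as $A^k(X)=\bigoplus_{p+q=k}A^{p,q}(X)$ and the exterior derivative splits as $d=\mu+\partial+\overline{\partial}+\bar\mu$ with $\mu:A^{p,q}\to A^{p+2,q-1}$, $\partial:A^{p,q}\to A^{p+1,q}$, $\overline{\partial}:A^{p,q}\to A^{p,q+1}$, $\bar\mu:A^{p,q}\to A^{p-1,q+2}$. For $X$ compact, $h^{p,0}_{\overline{\partial}}$ denotes the complex dimension of $\{\psi\in A^{p,0}(X):\overline{\partial}\psi=0\}$ (this equals the dimension of the $(p,0)$-forms in the kernel of $\Delta_{\overline\partial}=\overline\partial\,\overline\partial^*+\overline\partial^*\overline\partial$ for any Hermitian metric). The manifold. Let $G$ be the Lie group $\mathbb{R}^2\ltimes_\Phi\mathbb{R}^4$ with coordinates $(t,x,y_1,y_2,z_1,z_2)$ and product $(t,x,y_1,y_2,z_1,z_2)*(t',x',y_1',y_2',z_1',z_2')=(t+t',x+x',y_1'e^t+xz_1'e^t+y_1,\,y_2'e^{-t}+xz_2'e^{-t}+y_2,\,z_1'e^t+z_1,\,z_2'e^{-t}+z_2)$.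 Let $B\in SL(2,\mathbb{Z})$ have distinct eigenvalues $e^{a_0},e^{-a_0}$ ($a_0>0$) and $P$ a real invertible matrix with $PBP^{-1}=\mathrm{diag}(e^{a_0},e^{-a_0})$. Let $\Gamma$ be the lattice of elements with $t\in a_0\mathbb{Z}$, $x\in\mathbb{Z}$, $(y_1,y_2)=(m_1,m_2)P^t$, $(z_1,z_2)=(n_1,n_2)P^t$ with $m_i,n_i\in\mathbb{Z}$, and $X=\Gamma\backslash G$ (a compact $6$-dimensional solvmanifold). Left-invariant $1$-forms: $e^1=dt$, $e^2=dx$, $e^3=e^{-t}dy_1-xe^{-t}dz_1$, $e^4=e^{t}dy_2-xe^{t}dz_2$, $e^5=e^{-t}dz_1$, $e^6=e^tdz_2$, satisfying $de^1=de^2=0$, $de^3=-e^{13}-e^{25}$, $de^4=e^{14}-e^{26}$, $de^5=-e^{15}$, $de^6=e^{16}$ ($e^{ij}=e^i\wedge e^j$). The structures. For $a,b,c\in\mathbb{R}$, $a,c\neq 0$: $\omega_{a,b,c}=ae^{12}+be^{56}+c(e^{36}+e^{45})$ (a symplectic form), and $J_{a,b,c}$ is the almost-complex structure whose $(1,0)$-forms are spanned by $\varphi^1=ae^1+ie^2$, $\varphi^2=be^5+ce^3+ie^6$, $\varphi^3=ce^4+ie^5$. Then $\omega_{a,b,c}$ is $J_{a,b,c}$-compatible, so $(X,J_{a,b,c},\omega_{a,b,c})$ is almost-Kähler, with Hermitian metric $g_{a,b,c}(u,v)=\omega_{a,b,c}(u,J_{a,b,c}v)$. *)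

theory Defs
  imports "HOL-Analysis.Analysis"
begin

section \<open>The Lie group G = R^2 semidirect R^4 in coordinates (t,x,y1,y2,z1,z2)\<close>

type_synonym pt = "real \<times> real \<times> real \<times> real \<times> real \<times> real"

definition gmul :: "pt \<Rightarrow> pt \<Rightarrow> pt" where
  "gmul = (\<lambda>(t,x,y1,y2,z1,z2) (t',x',y1',y2',z1',z2').
      (t + t', x + x', y1' * exp t + x * z1' * exp t + y1,
       y2' * exp (-t) + x * z2' * exp (-t) + y2,
       z1' * exp t + z1, z2' * exp (-t) + z2))"

definition lattice :: "real \<Rightarrow> real^2^2 \<Rightarrow> pt set" where
  "lattice a0 P = {(t,x,y1,y2,z1,z2). (\<exists>k::int. t = a0 * of_int k) \<and> (\<exists>n::int. x = of_int n) \<and>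
      (\<exists>m1 m2 :: int. y1 = of_int m1 * P$1$1 + of_int m2 * P$1$2 \<and> y2 = of_int m1 * P$2$1 + of_int m2 * P$2$2) \<and>
      (\<exists>n1 n2 :: int. z1 = of_int n1 * P$1$1 + of_int n2 * P$1$2 \<and> z2 = of_int n1 * P$2$1 + of_int n2 * P$2$2)}"

definition coframe :: "nat \<Rightarrow> pt \<Rightarrow> real \<times> real \<times> real \<times> real \<times> real \<times> real" where
  "coframe i = (\<lambda>(t,x,y1,y2,z1,z2).
     if i = 1 then (1,0,0,0,0,0) else if i = 2 then (0,1,0,0,0,0)
     else if i = 3 then (0,0,exp(-t),0,-x*exp(-t),0)
     else if i = 4 then (0,0,0,exp t,0,-x*exp t)
     else if i = 5 then (0,0,0,0,exp(-t),0)
     else if i = 6 then (0,0,0,0,0,exp t) else (0,0,0,0,0,0))"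

definition Evec :: "nat \<Rightarrow> pt \<Rightarrow> pt" where
  "Evec i = (\<lambda>(t,x,y1,y2,z1,z2).
     if i = 1 then (1,0,0,0,0,0) else if i = 2 then (0,1,0,0,0,0)
     else if i = 3 then (0,0,exp t,0,0,0)
     else if i = 4 then (0,0,0,exp(-t),0,0)
     else if i = 5 then (0,0,x*exp t,0,exp t,0)
     else if i = 6 then (0,0,0,x*exp(-t),0,exp(-t)) else (0,0,0,0,0,0))"

lemma Evec_dual: "i \<in> {1..6} \<Longrightarrow> j \<in> {1..6} \<Longrightarrow> coframe i g \<bullet> Evec j g = (if i = j then 1 else 0)"
  by (cases g) (auto simp: coframe_def Evec_def exp_minus field_simps)

definition Eder :: "nat \<Rightarrow> (pt \<Rightarrow> complex) \<Rightarrow> pt \<Rightarrow> complex" where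
  "Eder i f g = frechet_derivative f (at g) (Evec i g)"

text \<open>e^{ab}(E_i,E_j).\<close>
definition ee :: "nat \<Rightarrow> nat \<Rightarrow> nat \<Rightarrow> nat \<Rightarrow> real" where
  "ee a b i j = (if a = i \<and> b = j then 1 else 0) - (if a = j \<and> b = i then 1 else 0)"

definition de :: "nat \<Rightarrow> nat \<Rightarrow> nat \<Rightarrow> real" where
  "de m i j = (if m = 3 then - ee 1 3 i j - ee 2 5 i j
      else if m = 4 then ee 1 4 i j - ee 2 6 i j
      else if m = 5 then - ee 1 5 i j
      else if m = 6 then ee 1 6 i j else 0)"

text \<open>Structure constants: [E_i,E_j] = sum_m cstr m i j E_m, where e^m([E_i,E_j]) = - de^m(E_i,E_j).\<close>
definition cstr :: "nat \<Rightarrow> nat \<Rightarrow> nat \<Rightarrow> real" where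
  "cstr m i j = - de m i j"

text \<open>A complex k-form is represented by its values on the frame:
  alpha g [i1,...,ik] = alpha_g(E_i1,...,E_ik).\<close>
type_synonym cform = "pt \<Rightarrow> nat list \<Rightarrow> complex"

fun Ck :: "nat \<Rightarrow> ('a::real_normed_vector \<Rightarrow> 'b::real_normed_vector) \<Rightarrow> bool" where
  "Ck 0 f = continuous_on UNIV f"
| "Ck (Suc k) f = ((\<forall>x. f differentiable (at x)) \<and> (\<forall>v. Ck k (\<lambda>x. frechet_derivative f (at x) v)))"

definition smooth_fun :: "('a::real_normed_vector \<Rightarrow> 'b::real_normed_vector) \<Rightarrow> bool" where
  "smooth_fun f = (\<forall>k. Ck k f)"

definition rem :: "nat \<Rightarrow> 'a list \<Rightarrow> 'a list" where
  "rem j L = take j L @ drop (Suc j) L"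

definition swap_pos :: "nat \<Rightarrow> nat \<Rightarrow> 'a list \<Rightarrow> 'a list" where
  "swap_pos i j L = L[i := L!j, j := L!i]"

text \<open>Smooth complex k-forms on the compact quotient X = Gamma\G (i.e. Gamma-left-invariant
  smooth forms on G, written in the left-invariant frame).\<close>
definition form_on_X :: "real \<Rightarrow> real^2^2 \<Rightarrow> nat \<Rightarrow> cform \<Rightarrow> bool" where
  "form_on_X a0 P k \<alpha> \<longleftrightarrow>
     (\<forall>g L. \<not> (length L = k \<and> set L \<subseteq> {1..6}) \<longrightarrow> \<alpha> g L = 0) \<and>
     (\<forall>g L i j. i < length L \<and> j < length L \<and> i \<noteq> j \<longrightarrow> \<alpha> g (swap_pos i j L) = - \<alpha> g L) \<and>
     (\<forall>L. smooth_fun (\<lambda>g. \<alpha> g L)) \<and>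
     (\<forall>\<gamma>\<in>lattice a0 P. \<forall>g L. \<alpha> (gmul \<gamma> g) L = \<alpha> g L)"

text \<open>Exterior derivative (Cartan formula in the left-invariant frame).\<close>
definition dform :: "cform \<Rightarrow> cform" where
  "dform \<alpha> g L =
     (\<Sum>j<length L. (-1)^j * Eder (L!j) (\<lambda>h. \<alpha> h (rem j L)) g) +
     (\<Sum>j<length L. \<Sum>l<length L. if j < l then
        (-1)^(j+l) * (\<Sum>m\<in>{1..6}. complex_of_real (cstr m (L!j) (L!l)) * \<alpha> g (m # rem j (rem l L)))
      else 0)"

text \<open>Evaluation of a form at g on complex tangent vectors (components w.r.t. E_1..E_6).\<close>
definition eval_form :: "cform \<Rightarrow> pt \<Rightarrow> (nat \<Rightarrow> complex) list \<Rightarrow> complex" where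
  "eval_form \<alpha> g vs = (\<Sum>L\<in>{L. set L \<subseteq> {1..6} \<and> length L = length vs}.
       (\<Prod>a<length vs. (vs!a) (L!a)) * \<alpha> g L)"

definition phic :: "real \<Rightarrow> real \<Rightarrow> real \<Rightarrow> nat \<Rightarrow> nat \<Rightarrow> complex" where
  "phic a b c k j =
     (if k = 1 then (if j = 1 then complex_of_real a else if j = 2 then \<i> else 0)
      else if k = 2 then (if j = 5 then complex_of_real b else if j = 3 then complex_of_real c else if j = 6 then \<i> else 0)
      else if k = 3 then (if j = 4 then complex_of_real c else if j = 5 then \<i> else 0)
      else 0)"

definition apply1 :: "(nat \<Rightarrow> complex) \<Rightarrow> (nat \<Rightarrow> complex) \<Rightarrow> complex" where
  "apply1 \<theta> v = (\<Sum>j\<in>{1..6}. \<theta> j * v j)"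

definition T10 :: "real \<Rightarrow> real \<Rightarrow> real \<Rightarrow> (nat \<Rightarrow> complex) set" where
  "T10 a b c = {v. \<forall>k\<in>{1,2,3}. apply1 (\<lambda>j. cnj (phic a b c k j)) v = 0}"

definition T01 :: "real \<Rightarrow> real \<Rightarrow> real \<Rightarrow> (nat \<Rightarrow> complex) set" where
  "T01 a b c = {v. \<forall>k\<in>{1,2,3}. apply1 (phic a b c k) v = 0}"

definition is_p0 :: "real \<Rightarrow> real \<Rightarrow> real \<Rightarrow> nat \<Rightarrow> cform \<Rightarrow> bool" where
  "is_p0 a b c p \<psi> \<longleftrightarrow> (\<forall>g vs. length vs = p \<and> (\<exists>v\<in>set vs. v \<in> T01 a b c) \<longrightarrow> eval_form \<psi> g vs = 0)"

text \<open>For a (p,0)-form psi, dbar psi = (d psi)^{p,1}; it vanishes iff d psi vanishes on every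
  tuple of p vectors of type (1,0) followed by one vector of type (0,1).\<close>
definition dbar_closed :: "real \<Rightarrow> real \<Rightarrow> real \<Rightarrow> nat \<Rightarrow> cform \<Rightarrow> bool" where
  "dbar_closed a b c p \<psi> \<longleftrightarrow>
     (\<forall>g vs w. length vs = p \<and> set vs \<subseteq> T10 a b c \<and> w \<in> T01 a b c \<longrightarrow>
        eval_form (dform \<psi>) g (vs @ [w]) = 0)"

definition Hp0 :: "real \<Rightarrow> real^2^2 \<Rightarrow> real \<Rightarrow> real \<Rightarrow> real \<Rightarrow> nat \<Rightarrow> cform set" where
  "Hp0 a0 P a b c p = {\<psi>. form_on_X a0 P p \<psi> \<and> is_p0 a b c p \<psi> \<and> dbar_closed a b c p \<psi>}"

definition lin_comb :: "nat \<Rightarrow> (nat \<Rightarrow> complex) \<Rightarrow> (nat \<Rightarrow> cform) \<Rightarrow> cform" where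
  "lin_comb n c B = (\<lambda>g L. \<Sum>i<n. c i * B i g L)"

definition has_cdim :: "cform set \<Rightarrow> nat \<Rightarrow> bool" where
  "has_cdim S n \<longleftrightarrow> (\<exists>B. (\<forall>c. lin_comb n c B = (\<lambda>g L. 0) \<longrightarrow> (\<forall>i<n. c i = 0)) \<and>
                         S = {lin_comb n c B | c. True})"

definition phi1_form :: "real \<Rightarrow> real \<Rightarrow> real \<Rightarrow> cform" where
  "phi1_form a b c = (\<lambda>g L. if length L = 1 \<and> L!0 \<in> {1..6} then phic a b c 1 (L!0) else 0)"

definition det3 :: "(nat \<Rightarrow> nat \<Rightarrow> complex) \<Rightarrow> complex" where
  "det3 M = M 0 0 * M 1 1 * M 2 2 + M 0 1 * M 1 2 * M 2 0 + M 0 2 * M 1 0 * M 2 1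
          - M 0 2 * M 1 1 * M 2 0 - M 0 0 * M 1 2 * M 2 1 - M 0 1 * M 1 0 * M 2 2"

definition phi123_form :: "real \<Rightarrow> real \<Rightarrow> real \<Rightarrow> cform" where
  "phi123_form a b c = (\<lambda>g L. if length L = 3 \<and> set L \<subseteq> {1..6}
        then det3 (\<lambda>r s. phic a b c (Suc r) (L!s)) else 0)"

end

theory Submission
  imports Defs "HOL-Complex_Analysis.Cauchy_Integral_Formula"
begin

text \<open>
  Let \<open>V\<^sub>1, V\<^sub>2, V\<^sub>3\<close> be the left-invariant frame dual to \<open>\<phi>\<^sup>1, \<phi>\<^sup>2, \<phi>\<^sup>3\<close>. A \<open>(p,0)\<close>-form is determined
  by the functions \<open>f\<^sub>K = \<psi>(V\<^sub>K)\<close>, and \<open>\<partial>\<close>-bar closedness becomes a first-order linear system for them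
  with constant coefficients. For fixed \<open>(t,x)\<close> the conjugates of \<open>V\<^sub>2, V\<^sub>3\<close> are the Cauchy-Riemann
  operators of a complex structure on the torus fibre with coordinates \<open>(y,z)\<close>. A bounded function
  on the plane whose Cauchy-Riemann derivative is a constant is itself constant, and that constant is
  zero (Liouville); this makes the coefficients functions of \<open>(t,x)\<close> and forces the unwanted ones
  to vanish. The conjugate of \<open>V\<^sub>1\<close> is the Cauchy-Riemann operator in \<open>a t + i x\<close>, so the remaining
  untwisted coefficients are constant. In degree two the combinations \<open>f\<^sub>1\<^sub>2 \<plusminus> f\<^sub>1\<^sub>3\<close> satisfy a
  twisted equation with solutions \<open>C exp (\<minusplus> i c x / 2)\<close>, and these have period one in \<open>x\<close>
  iff \<open>C = 0\<close> or \<open>c\<close> is an integer multiple of \<open>4 \<pi>\<close>.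
\<close>

section \<open>Multilinear evaluation and the Cartan formula\<close>

lemma eval_form_Nil [simp]: "eval_form \<alpha> g [] = \<alpha> g []"
proof -
  have "{L. set L \<subseteq> {1..6::nat} \<and> length L = length ([]::(nat\<Rightarrow>complex) list)} = {[]}"
    by auto
  then show ?thesis unfolding eval_form_def by simp
qed

text \<open>Lists of length n + 1 are pairs of head and tail, so the sum factors through the first
  slot. This recursion drives the inductions on multilinearity below.\<close>

lemma eval_form_Cons:
  "eval_form \<alpha> g (v # vs) = (\<Sum>i\<in>{1..6}. v i * eval_form (\<lambda>h L. \<alpha> h (i # L)) g vs)"
proof -
  let ?A = "{L. set L \<subseteq> {1..6::nat} \<and> length L = length vs}"
  have "eval_form \<alpha> g (v # vs) =
      (\<Sum>L\<in>(\<lambda>(xs, n). n # xs) ` (?A \<times> {1..6}). (\<Prod>a<length (v # vs). ((v # vs)!a) (L!a)) * \<alpha> g L)"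
    unfolding eval_form_def by (simp only: list.size lists_length_Suc_eq add_Suc_right add_0_right)
  also have "\<dots> = (\<Sum>(xs, n)\<in>?A \<times> {1..6}. v n * (\<Prod>a<length vs. (vs!a) (xs!a)) * \<alpha> g (n # xs))"
    by (subst sum.reindex)
       (auto simp: inj_on_def prod.lessThan_Suc_shift simp del: prod.lessThan_Suc intro!: sum.cong)
  also have "\<dots> = (\<Sum>n\<in>{1..6}. \<Sum>xs\<in>?A. v n * (\<Prod>a<length vs. (vs!a) (xs!a)) * \<alpha> g (n # xs))"
    by (subst sum.swap) (simp add: sum.cartesian_product)
  finally show ?thesis by (simp add: eval_form_def sum_distrib_left mult.assoc)
qed

lemma eval_form_cong:
  assumes "\<And>L. length L = length vs \<Longrightarrow> set L \<subseteq> {1..6} \<Longrightarrow> \<alpha> g L = \<beta> g L"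
  shows "eval_form \<alpha> g vs = eval_form \<beta> g vs"
  unfolding eval_form_def using assms by (intro sum.cong) auto

lemma eval_form_sum:
  "eval_form (\<lambda>h L. \<Sum>x\<in>A. F x h L) g vs = (\<Sum>x\<in>A. eval_form (F x) g vs)"
  unfolding eval_form_def sum_distrib_left by (rule sum.swap)

lemma eval_form_add:
  "eval_form (\<lambda>h L. \<alpha> h L + \<beta> h L) g vs = eval_form \<alpha> g vs + eval_form \<beta> g vs"
  unfolding eval_form_def by (simp add: sum.distrib distrib_left)

lemma eval_form_scale:
  "eval_form (\<lambda>h L. k h * \<alpha> h L) g vs = k g * eval_form \<alpha> g vs"
  unfolding eval_form_def sum_distrib_left by (intro sum.cong) auto

lemma eval_form_minus: "eval_form (\<lambda>h L. - \<alpha> h L) g vs = - eval_form \<alpha> g vs"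
  using eval_form_scale[of "\<lambda>_. -1" \<alpha> g vs] by simp

lemma rem_0 [simp]: "rem 0 (x # xs) = xs"
  by (simp add: rem_def)

lemma rem_Suc [simp]: "rem (Suc j) (x # xs) = x # rem j xs"
  by (simp add: rem_def)

lemma length_rem: "j < length xs \<Longrightarrow> length (rem j xs) = length xs - 1"
  by (simp add: rem_def)

lemma rem_nth: "j < l \<Longrightarrow> l < length xs \<Longrightarrow> rem l xs ! j = xs ! j"
  by (simp add: rem_def nth_append)

lemma rem_append: "j < length xs \<Longrightarrow> rem j (xs @ ys) = rem j xs @ ys"
  by (simp add: rem_def)

lemma rem_length_snoc: "rem (length xs) (xs @ [y]) = xs"
  by (simp add: rem_def)

lemma rem_map: "rem j (map f xs) = map f (rem j xs)"
  by (simp add: rem_def take_map drop_map)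

text \<open>In the Cartan formula the index in slot \<open>j\<close> selects a derivation or a
  structure constant, while the remaining indices feed the form. The family \<open>G\<close> records
  both roles, so that slot \<open>j\<close> can be summed out separately.\<close>

lemma eval_form_split_slot:
  assumes "j < length vs"
  shows "eval_form (\<lambda>h L. G (L!j) h (rem j L)) g vs = (\<Sum>i\<in>{1..6}. (vs!j) i * eval_form (G i) g (rem j vs))"
  using assms
proof (induction j arbitrary: vs G)
  case 0
  then show ?case by (cases vs) (auto simp: eval_form_Cons)
next
  case (Suc j)
  then obtain v ws where vs: "vs = v # ws" and j: "j < length ws" by (cases vs) auto
  have "eval_form (\<lambda>h L. G (L ! Suc j) h (rem (Suc j) L)) g vs =
      (\<Sum>k\<in>{1..6}. v k * (\<Sum>i\<in>{1..6}. (ws!j) i * eval_form (\<lambda>h L. G i h (k # L)) g (rem j ws)))"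
    unfolding vs eval_form_Cons
    using Suc.IH[OF j, of "\<lambda>i h M. G i h (k # M)" for k] by simp
  also have "\<dots> = (\<Sum>i\<in>{1..6}. (vs ! Suc j) i * eval_form (G i) g (rem (Suc j) vs))"
    unfolding vs sum_distrib_left
    by (subst sum.swap) (simp add: eval_form_Cons sum_distrib_left mult.left_commute)
  finally show ?case .
qed

text \<open>The components outside \<open>{1..6}\<close> carry no information, so vectors are only compared there.\<close>
lemma eval_form_slot_sum:
  assumes "\<And>i. i \<in> {1..6} \<Longrightarrow> u i = (\<Sum>k\<in>A. q k * U k i)"
  shows "eval_form \<alpha> g (xs @ u # ys) = (\<Sum>k\<in>A. q k * eval_form \<alpha> g (xs @ U k # ys))"
proof (induction xs arbitrary: \<alpha>)
  case Nil
  have "eval_form \<alpha> g (u # ys) =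
      (\<Sum>i\<in>{1..6}. \<Sum>k\<in>A. q k * (U k i * eval_form (\<lambda>h L. \<alpha> h (i # L)) g ys))"
    unfolding eval_form_Cons by (intro sum.cong) (auto simp: assms sum_distrib_right mult.assoc)
  also have "\<dots> = (\<Sum>k\<in>A. q k * eval_form \<alpha> g (U k # ys))"
    by (subst sum.swap) (simp add: eval_form_Cons sum_distrib_left)
  finally show ?case by simp
next
  case (Cons x xs)
  show ?case
    unfolding append_Cons eval_form_Cons Cons.IH sum_distrib_left
    by (subst sum.swap) (simp add: mult.left_commute)
qed

text \<open>Exchanging two index sums turns alternation in the indices into alternation in the
  vectors. The hypothesis ranges over all prefixes, so it survives fixing the first index in the
  induction.\<close>

lemma eval_form_swap_adjacent:
  assumes "\<And>xs i j ys. \<alpha> g (xs @ i # j # ys) = - \<alpha> g (xs @ j # i # ys)"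
  shows "eval_form \<alpha> g (xs @ u # v # ys) = - eval_form \<alpha> g (xs @ v # u # ys)"
  using assms
proof (induction xs arbitrary: \<alpha>)
  case Nil
  have *: "eval_form (\<lambda>h L. \<alpha> h (i # j # L)) g ys = - eval_form (\<lambda>h L. \<alpha> h (j # i # L)) g ys" for i j
    unfolding eval_form_minus[symmetric] by (rule eval_form_cong) (rule Nil[of "[]", simplified append_Nil])
  have "eval_form \<alpha> g (u # v # ys) = (\<Sum>i\<in>{1..6}. \<Sum>j\<in>{1..6}. u i * (v j * eval_form (\<lambda>h L. \<alpha> h (i # j # L)) g ys))"
    by (simp add: eval_form_Cons sum_distrib_left)
  also have "\<dots> = (\<Sum>j\<in>{1..6}. \<Sum>i\<in>{1..6}. u i * (v j * - eval_form (\<lambda>h L. \<alpha> h (j # i # L)) g ys))"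
    by (subst sum.swap) (subst *, rule refl)
  also have "\<dots> = - eval_form \<alpha> g (v # u # ys)"
    by (simp add: eval_form_Cons sum_distrib_left sum_negf mult.left_commute)
  finally show ?case by simp
next
  case (Cons x xs)
  have "eval_form (\<lambda>h L. \<alpha> h (i # L)) g (xs @ u # v # ys) = - eval_form (\<lambda>h L. \<alpha> h (i # L)) g (xs @ v # u # ys)"
    (is "?l i = - ?r i") for i
    by (rule Cons.IH) (rule Cons.prems[of "i # _", unfolded append_Cons])
  then have "(\<Sum>i\<in>{1..6}. x i * ?l i) = (\<Sum>i\<in>{1..6}. x i * - ?r i)"
    by (intro sum.cong refl arg_cong2[where f = "(*)"])
  then show ?case by (simp only: append_Cons eval_form_Cons mult_minus_right sum_negf)
qed

section \<open>Cartan formula for left-invariant complex fields\<close>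

definition dir_deriv :: "(nat \<Rightarrow> complex) \<Rightarrow> (pt \<Rightarrow> complex) \<Rightarrow> pt \<Rightarrow> complex" where
  "dir_deriv v f g = (\<Sum>i\<in>{1..6}. v i * Eder i f g)"

text \<open>Vectors are tuples of constant coefficients, i.e. left-invariant complex fields, so the
  Lie bracket is the bilinear extension of the structure constants, with no derivatives of
  coefficients.\<close>

definition bracket :: "(nat \<Rightarrow> complex) \<Rightarrow> (nat \<Rightarrow> complex) \<Rightarrow> nat \<Rightarrow> complex" where
  "bracket u v m = (\<Sum>i\<in>{1..6}. \<Sum>j\<in>{1..6}. complex_of_real (cstr m i j) * u i * v j)"

lemma has_derivative_eval_form:
  assumes "\<And>L. (\<lambda>h. \<alpha> h L) differentiable at g"
  shows "((\<lambda>h. eval_form \<alpha> h vs) has_derivative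
          (\<lambda>d. eval_form (\<lambda>h L. frechet_derivative (\<lambda>h. \<alpha> h L) (at g) d) g vs)) (at g)"
  unfolding eval_form_def
proof (intro has_derivative_sum has_derivative_mult_right)
  fix L
  show "((\<lambda>h. \<alpha> h L) has_derivative frechet_derivative (\<lambda>h. \<alpha> h L) (at g)) (at g)"
    using assms[of L] unfolding frechet_derivative_works .
qed

lemma Eder_eval_form:
  assumes "\<And>L. (\<lambda>h. \<alpha> h L) differentiable at g"
  shows "Eder i (\<lambda>h. eval_form \<alpha> h vs) g = eval_form (\<lambda>h L. Eder i (\<lambda>h. \<alpha> h L) h) g vs"
proof -
  have "frechet_derivative (\<lambda>h. eval_form \<alpha> h vs) (at g) =
      (\<lambda>d. eval_form (\<lambda>h L. frechet_derivative (\<lambda>h. \<alpha> h L) (at g) d) g vs)"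
    by (rule frechet_derivative_at[symmetric], rule has_derivative_eval_form, rule assms)
  then show ?thesis
    unfolding Eder_def by (simp only:) (rule eval_form_cong, rule refl)
qed

text \<open>\<open>dform\<close> gives the Cartan formula on frame vectors only. Both of its sums
  extend to constant combinations of these by multilinearity.\<close>

lemma eval_dform:
  assumes diff: "\<And>L. (\<lambda>h. \<alpha> h L) differentiable at g"
  shows "eval_form (dform \<alpha>) g vs =
     (\<Sum>j<length vs. (-1)^j * dir_deriv (vs!j) (\<lambda>h. eval_form \<alpha> h (rem j vs)) g) +
     (\<Sum>j<length vs. \<Sum>l<length vs. if j < l then
        (-1)^(j+l) * eval_form \<alpha> g (bracket (vs!j) (vs!l) # rem j (rem l vs)) else 0)"
proof -
  let ?n = "length vs"
  let ?D = "\<lambda>i h M. Eder i (\<lambda>h. \<alpha> h M) h"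
  let ?C = "\<lambda>i k h M. \<Sum>m\<in>{1..6}. complex_of_real (cstr m i k) * \<alpha> h (m # M)"
  have "eval_form (dform \<alpha>) g vs = eval_form (\<lambda>h L.
     (\<Sum>j<?n. (-1)^j * ?D (L!j) h (rem j L)) +
     (\<Sum>j<?n. \<Sum>l<?n. (if j < l then (-1)^(j+l) else 0) * ?C (L!j) (L!l) h (rem j (rem l L)))) g vs"
    by (rule eval_form_cong) (auto simp: dform_def intro!: sum.cong)
  also have "\<dots> = (\<Sum>j<?n. (-1)^j * eval_form (\<lambda>h L. ?D (L!j) h (rem j L)) g vs) +
     (\<Sum>j<?n. \<Sum>l<?n. (if j < l then (-1)^(j+l) else 0) *
        eval_form (\<lambda>h L. ?C (L!j) (L!l) h (rem j (rem l L))) g vs)"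
    unfolding eval_form_add eval_form_sum eval_form_scale ..
  also have "(\<Sum>j<?n. (-1)^j * eval_form (\<lambda>h L. ?D (L!j) h (rem j L)) g vs) =
      (\<Sum>j<?n. (-1)^j * dir_deriv (vs!j) (\<lambda>h. eval_form \<alpha> h (rem j vs)) g)"
    by (intro sum.cong refl)
       (simp add: eval_form_split_slot[where G = ?D] dir_deriv_def Eder_eval_form[OF diff])
  also have "(\<Sum>j<?n. \<Sum>l<?n. (if j < l then (-1)^(j+l) else 0) *
        eval_form (\<lambda>h L. ?C (L!j) (L!l) h (rem j (rem l L))) g vs) =
      (\<Sum>j<?n. \<Sum>l<?n. if j < l then
        (-1)^(j+l) * eval_form \<alpha> g (bracket (vs!j) (vs!l) # rem j (rem l vs)) else 0)"
  proof (intro sum.cong refl)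
    fix j l assume "j \<in> {..<?n}" "l \<in> {..<?n}"
    then have jn: "j < ?n" and ln: "l < ?n" by auto
    have "eval_form (\<lambda>h L. ?C (L!j) (L!l) h (rem j (rem l L))) g vs =
        eval_form \<alpha> g (bracket (vs!j) (vs!l) # rem j (rem l vs))" if jl: "j < l"
    proof -
      let ?W = "rem j (rem l vs)"
      let ?e = "\<lambda>m. eval_form (\<lambda>h M. \<alpha> h (m # M)) g ?W"
      \<comment> \<open>Slot \<open>l\<close> is taken out first: as \<open>j < l\<close>, position
        \<open>j\<close> still holds the same vector afterwards, and the slot lemma applies a second
        time.\<close>
      have j': "j < length (rem l vs)" using jl ln by (simp add: length_rem)
      have "eval_form (\<lambda>h L. ?C (L!j) (L!l) h (rem j (rem l L))) g vs =
          eval_form (\<lambda>h L. ?C (rem l L ! j) (L!l) h (rem j (rem l L))) g vs"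
        by (rule eval_form_cong) (use jl ln in \<open>simp add: rem_nth\<close>)
      also have "\<dots> = (\<Sum>k\<in>{1..6}. (vs!l) k * (\<Sum>i\<in>{1..6}. (vs!j) i * eval_form (?C i k) g ?W))"
        using eval_form_split_slot[OF ln, of "\<lambda>k h M. ?C (M!j) k h (rem j M)"]
          eval_form_split_slot[OF j', of "\<lambda>i. ?C i k" for k]
        by (simp only: rem_nth[OF jl ln])
      also have "\<dots> = (\<Sum>k\<in>{1..6}. \<Sum>i\<in>{1..6}. \<Sum>m\<in>{1..6}. complex_of_real (cstr m i k) * (vs!j) i * (vs!l) k * ?e m)"
        by (simp add: eval_form_sum eval_form_scale sum_distrib_left mult_ac)
      also have "\<dots> = (\<Sum>i\<in>{1..6}. \<Sum>k\<in>{1..6}. \<Sum>m\<in>{1..6}. complex_of_real (cstr m i k) * (vs!j) i * (vs!l) k * ?e m)"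
        by (rule sum.swap)
      also have "\<dots> = (\<Sum>i\<in>{1..6}. \<Sum>m\<in>{1..6}. \<Sum>k\<in>{1..6}. complex_of_real (cstr m i k) * (vs!j) i * (vs!l) k * ?e m)"
        by (intro sum.cong refl sum.swap)
      also have "\<dots> = (\<Sum>m\<in>{1..6}. \<Sum>i\<in>{1..6}. \<Sum>k\<in>{1..6}. complex_of_real (cstr m i k) * (vs!j) i * (vs!l) k * ?e m)"
        by (rule sum.swap)
      also have "\<dots> = eval_form \<alpha> g (bracket (vs!j) (vs!l) # ?W)"
        by (simp add: eval_form_Cons bracket_def sum_distrib_right)
      finally show ?thesis .
    qed
    then show "(if j < l then (-1)^(j+l) else 0) *
        eval_form (\<lambda>h L. ?C (L!j) (L!l) h (rem j (rem l L))) g vs =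
      (if j < l then (-1)^(j+l) * eval_form \<alpha> g (bracket (vs!j) (vs!l) # rem j (rem l vs)) else 0)"
      by auto
  qed
  finally show ?thesis .
qed

lemma Eder_const [simp]: "Eder i (\<lambda>h. k) g = 0"
  unfolding Eder_def by simp

lemma dir_deriv_const [simp]: "dir_deriv v (\<lambda>h. k) g = 0"
  unfolding dir_deriv_def by simp

text \<open>All terms of the Cartan formula in which \<open>w\<close> survives as an argument of \<open>\<psi>\<close> vanish.\<close>
lemma eval_dform_p0:
  assumes diff: "\<And>L. (\<lambda>h. \<psi> h L) differentiable at g"
    and p0: "is_p0 a b c (length vs) \<psi>" and w: "w \<in> T01 a b c"
  shows "eval_form (dform \<psi>) g (vs @ [w]) = (-1)^length vs *
     (dir_deriv w (\<lambda>h. eval_form \<psi> h vs) g +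
      (\<Sum>j<length vs. (-1)^j * eval_form \<psi> g (bracket (vs!j) w # rem j vs)))"
proof -
  let ?p = "length vs" and ?vs = "vs @ [w]"
  have zero: "eval_form \<psi> h us = 0" if "length us = ?p" "w \<in> set us" for us h
    using p0 that w unfolding is_p0_def by blast
  have A: "dir_deriv (?vs!j) (\<lambda>h. eval_form \<psi> h (rem j ?vs)) g = 0" if "j < ?p" for j
  proof -
    have "eval_form \<psi> h (rem j ?vs) = 0" for h
      by (rule zero) (use that in \<open>auto simp: rem_append length_rem\<close>)
    then show ?thesis by simp
  qed
  have B: "eval_form \<psi> g (bracket (?vs!j) (?vs!l) # rem j (rem l ?vs)) = 0" if "j < l" "l < ?p" for j l
    by (rule zero) (use that in \<open>auto simp: rem_append length_rem\<close>)
  have C: "(\<Sum>l<Suc ?p. if j < l then (-1)^(j+l) *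
        eval_form \<psi> g (bracket (?vs!j) (?vs!l) # rem j (rem l ?vs)) else 0) =
      (if j < ?p then (-1)^(j+?p) * eval_form \<psi> g (bracket (vs!j) w # rem j vs) else 0)" for j
    using B[of j] by (auto simp: rem_length_snoc nth_append intro!: sum.neutral)
  have "eval_form (dform \<psi>) g ?vs =
     (\<Sum>j<Suc ?p. (-1)^j * dir_deriv (?vs!j) (\<lambda>h. eval_form \<psi> h (rem j ?vs)) g) +
     (\<Sum>j<Suc ?p. \<Sum>l<Suc ?p. if j < l then
        (-1)^(j+l) * eval_form \<psi> g (bracket (?vs!j) (?vs!l) # rem j (rem l ?vs)) else 0)"
    using eval_dform[where vs = ?vs and \<alpha> = \<psi>, OF diff] by (simp only: length_append_singleton)
  also have "\<dots> = (-1)^?p * dir_deriv w (\<lambda>h. eval_form \<psi> h vs) g +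
     (\<Sum>j<?p. (-1)^(j+?p) * eval_form \<psi> g (bracket (vs!j) w # rem j vs))"
    unfolding C using A by (simp add: rem_length_snoc)
  finally show ?thesis
    by (simp add: distrib_left sum_distrib_left power_add mult_ac)
qed

section \<open>The frame dual to \<open>\<phi>\<close>\<close>

text \<open>Solving phi^k(V_l) = delta_kl and conj phi^k(V_l) = 0 gives V_1 = (E_1/a - i E_2)/2, V_2
  = (E_3/c - i E_6)/2 and V_3 = (E_4/c - i E_5 + i (b/c) E_3)/2. The E_3 part of V_3 cancels the
  term b e^5 of phi^2.\<close>

definition frame10 :: "real \<Rightarrow> real \<Rightarrow> real \<Rightarrow> nat \<Rightarrow> nat \<Rightarrow> complex" where
  "frame10 a b c k j =
     (if k = 1 then (if j = 1 then complex_of_real (1 / (2 * a)) else if j = 2 then - \<i> / 2 else 0)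
      else if k = 2 then (if j = 3 then complex_of_real (1 / (2 * c)) else if j = 6 then - \<i> / 2 else 0)
      else if k = 3 then (if j = 3 then \<i> * complex_of_real (b / (2 * c))
        else if j = 4 then complex_of_real (1 / (2 * c)) else if j = 5 then - \<i> / 2 else 0)
      else 0)"

definition frame01 :: "real \<Rightarrow> real \<Rightarrow> real \<Rightarrow> nat \<Rightarrow> nat \<Rightarrow> complex" where
  "frame01 a b c k j = cnj (frame10 a b c k j)"

text \<open>The component of \<open>[V\<^sub>j, cnj V\<^sub>k]\<close> along \<open>V\<^sub>m\<close>, for the frame \<open>V\<close> dual to \<open>\<phi>\<close>.\<close>
definition conn :: "real \<Rightarrow> real \<Rightarrow> nat \<Rightarrow> nat \<Rightarrow> nat \<Rightarrow> complex" where
  "conn a c m j k = complex_of_real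
     (if (m, j, k) = (2, 1, 2) then 1 / (2 * a)
      else if (m, j, k) = (3, 1, 3) then - 1 / (2 * a)
      else if (m, j, k) = (2, 1, 3) \<or> (m, j, k) = (3, 1, 2) then c / 4
      else if (m, j, k) = (2, 3, 1) \<or> (m, j, k) = (3, 2, 1) then - c / 4
      else 0)"

lemma sum_1_6: "(\<Sum>i\<in>{1..6::nat}. f i) = f 1 + f 2 + f 3 + f 4 + f 5 + (f 6 :: 'a :: comm_monoid_add)"
proof -
  have "{1..6::nat} = {1,2,3,4,5,6}" by auto
  then show ?thesis by (simp add: add.assoc)
qed

lemma sum_1_3: "(\<Sum>k\<in>{1,2,3::nat}. f k) = f 1 + (f 2 + (f 3 :: 'a :: comm_monoid_add))"
  by simp

lemma apply1_phic:
  "apply1 (phic a b c 1) u = a * u 1 + \<i> * u 2"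
  "apply1 (phic a b c 2) u = c * u 3 + b * u 5 + \<i> * u 6"
  "apply1 (phic a b c 3) u = c * u 4 + \<i> * u 5"
  "apply1 (\<lambda>j. cnj (phic a b c 1 j)) u = a * u 1 - \<i> * u 2"
  "apply1 (\<lambda>j. cnj (phic a b c 2 j)) u = c * u 3 + b * u 5 - \<i> * u 6"
  "apply1 (\<lambda>j. cnj (phic a b c 3 j)) u = c * u 4 - \<i> * u 5"
  unfolding apply1_def sum_1_6 by (simp_all add: phic_def)

lemma bracket_components:
  "bracket u v 1 = 0"
  "bracket u v 2 = 0"
  "bracket u v 3 = (u 1 * v 3 - u 3 * v 1) + (u 2 * v 5 - u 5 * v 2)"
  "bracket u v 4 = - (u 1 * v 4 - u 4 * v 1) + (u 2 * v 6 - u 6 * v 2)"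
  "bracket u v 5 = u 1 * v 5 - u 5 * v 1"
  "bracket u v 6 = - (u 1 * v 6 - u 6 * v 1)"
  unfolding bracket_def sum_1_6 by (simp_all add: cstr_def de_def ee_def)

lemma apply1_linear:
  "apply1 \<theta> (\<lambda>i. u i - (\<Sum>k\<in>A. q k * U k i)) = apply1 \<theta> u - (\<Sum>k\<in>A. q k * apply1 \<theta> (U k))"
proof -
  have "(\<Sum>j\<in>{1..6}. \<Sum>k\<in>A. \<theta> j * (q k * U k j)) = (\<Sum>k\<in>A. \<Sum>j\<in>{1..6}. q k * (\<theta> j * U k j))"
    by (subst sum.swap) (simp add: mult.left_commute)
  then show ?thesis
    by (simp add: apply1_def right_diff_distrib sum_subtractf sum_distrib_left)
qed

section \<open>Expansion in the dual frame and reduction to a linear system\<close>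

context
  fixes a b c :: real
  assumes a_nz: "a \<noteq> 0" and c_nz: "c \<noteq> 0"
begin

lemma apply1_phic_frame10:
  assumes "k \<in> {1,2,3}" "l \<in> {1,2,3}"
  shows "apply1 (phic a b c k) (frame10 a b c l) = (if k = l then 1 else 0)"
  using assms a_nz c_nz by (auto simp: apply1_phic[simplified] frame10_def)

lemma frame01_in_T01: "k \<in> {1,2,3} \<Longrightarrow> frame01 a b c k \<in> T01 a b c"
  using a_nz c_nz by (auto simp: T01_def apply1_phic[simplified] frame01_def frame10_def)

lemma frame10_in_T10: "k \<in> {1,2,3} \<Longrightarrow> frame10 a b c k \<in> T10 a b c"
  using a_nz c_nz by (auto simp: T10_def apply1_phic[simplified] frame10_def)

text \<open>The three conjugate equations determine the components 1, 3 and 4 of \<open>u\<close>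
  from 2, 5 and 6; after this substitution each component can be compared with the frame.\<close>

lemma T10_expand:
  assumes "u \<in> T10 a b c" "i \<in> {1..6}"
  shows "u i = (\<Sum>k\<in>{1,2,3}. apply1 (phic a b c k) u * frame10 a b c k i)"
proof -
  have *: "a * u 1 = \<i> * u 2" "c * u 3 + b * u 5 = \<i> * u 6" "c * u 4 = \<i> * u 5"
    using assms(1) by (auto simp: T10_def apply1_phic[simplified])
  have "u 1 = \<i> * u 2 / a" "u 3 = (\<i> * u 6 - b * u 5) / c" "u 4 = \<i> * u 5 / c"
    using a_nz c_nz *[symmetric] by (simp_all add: field_simps)
  moreover have "i = 1 \<or> i = 2 \<or> i = 3 \<or> i = 4 \<or> i = 5 \<or> i = 6" using assms(2) by auto
  ultimately show ?thesis
    unfolding sum_1_3 apply1_phic using a_nz c_nz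
    by (elim disjE) (simp_all add: frame10_def divide_simps, simp_all add: algebra_simps)
qed

lemma T01_expand:
  assumes "u \<in> T01 a b c" "i \<in> {1..6}"
  shows "u i = (\<Sum>k\<in>{1,2,3}. apply1 (\<lambda>j. cnj (phic a b c k j)) u * frame01 a b c k i)"
proof -
  have "(\<lambda>j. cnj (u j)) \<in> T10 a b c"
  proof -
    have "apply1 (\<lambda>j. cnj (phic a b c k j)) (\<lambda>j. cnj (u j)) = cnj (apply1 (phic a b c k) u)" for k
      by (simp add: apply1_def)
    then show ?thesis using assms(1) by (simp add: T01_def T10_def)
  qed
  from arg_cong[OF T10_expand[OF this assms(2)], of cnj] show ?thesis
    by (simp add: frame01_def apply1_def)
qed

text \<open>Subtracting from \<open>u\<close> its components along V_1, V_2, V_3 leaves a vector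
  killed by every phi^k. It has type (0,1), so the form vanishes on it.\<close>

lemma p0_slot_expand:
  assumes p0: "is_p0 a b c p \<psi>" and len: "length (xs @ u # ys) = p"
  shows "eval_form \<psi> g (xs @ u # ys) =
     (\<Sum>k\<in>{1,2,3}. apply1 (phic a b c k) u * eval_form \<psi> g (xs @ frame10 a b c k # ys))"
proof -
  let ?q = "\<lambda>k. apply1 (phic a b c k) u"
  define r where "r = (\<lambda>i. u i - (\<Sum>k\<in>{1,2,3}. ?q k * frame10 a b c k i))"
  have "apply1 (phic a b c l) r = 0" if "l \<in> {1,2,3}" for l
    unfolding r_def apply1_linear using that by (auto simp: apply1_phic_frame10)
  then have r: "r \<in> T01 a b c" by (auto simp: T01_def)
  \<comment> \<open>Index 0 carries the (0,1) remainder, so that the whole decomposition is a single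
    sum to which \<open>eval_form_slot_sum\<close> applies.\<close>
  let ?U = "\<lambda>k. if k = 0 then r else frame10 a b c k"
  have "eval_form \<psi> g (xs @ u # ys) =
      (\<Sum>k\<in>{0,1,2,3}. (if k = 0 then 1 else ?q k) * eval_form \<psi> g (xs @ ?U k # ys))"
    by (rule eval_form_slot_sum) (simp add: r_def)
  moreover have "eval_form \<psi> g (xs @ r # ys) = 0"
    using p0 len r unfolding is_p0_def by (metis append_Cons length_Cons length_append in_set_conv_decomp)
  ultimately show ?thesis by simp
qed

lemma apply1_phic_bracket:
  assumes "m \<in> {1,2,3}" "j \<in> {1,2,3}" "k \<in> {1,2,3}"
  shows "apply1 (phic a b c m) (bracket (frame10 a b c j) (frame01 a b c k)) = conn a c m j k"
  using assms a_nz c_nz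
  by (elim insertE emptyE; simp only: apply1_phic bracket_components)
     (simp_all add: frame10_def frame01_def conn_def field_simps)

text \<open>The arguments are traded for frame vectors from left to right. \<open>K\<close> collects
  those already replaced, and the induction runs over those still to be replaced.\<close>

lemma p0_eval_eqI:
  assumes "is_p0 a b c p \<alpha>" "is_p0 a b c p \<beta>"
    and "\<And>K. length K = p \<Longrightarrow> set K \<subseteq> {1,2,3} \<Longrightarrow>
      eval_form \<alpha> g (map (frame10 a b c) K) = eval_form \<beta> g (map (frame10 a b c) K)"
    and "length K + length us = p" "set K \<subseteq> {1,2,3}"
  shows "eval_form \<alpha> g (map (frame10 a b c) K @ us) = eval_form \<beta> g (map (frame10 a b c) K @ us)"
  using assms(4,5)
proof (induction us arbitrary: K)
  case Nil
  then show ?case using assms(3) by simp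
next
  case (Cons u us)
  have "eval_form \<alpha> g (map (frame10 a b c) K @ frame10 a b c k # us) =
      eval_form \<beta> g (map (frame10 a b c) K @ frame10 a b c k # us)" if "k \<in> {1,2,3}" for k
    using Cons.IH[of "K @ [k]"] Cons.prems that by simp
  moreover have "length (map (frame10 a b c) K @ u # us) = p" using Cons.prems by simp
  ultimately show ?case
    unfolding p0_slot_expand[OF assms(1) \<open>length _ = p\<close>] p0_slot_expand[OF assms(2) \<open>length _ = p\<close>]
    by (intro sum.cong) auto
qed

lemma eval_form_units:
  "set L \<subseteq> {1..6} \<Longrightarrow> eval_form \<alpha> g (map (\<lambda>i j. if j = i then 1 else 0) L) = \<alpha> g L"
proof (induction L arbitrary: \<alpha>)
  case (Cons i L)
  have "eval_form \<alpha> g (map (\<lambda>i j. if j = i then 1 else 0) (i # L)) =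
      (\<Sum>j\<in>{1..6}. if j = i then \<alpha> g (j # L) else 0)"
    unfolding list.map eval_form_Cons using Cons by (intro sum.cong) auto
  then show ?case using Cons.prems by simp
qed simp

text \<open>Evaluation on unit vectors recovers the coefficients of a form. These vectors are not of
  type (1,0), and it is the (p,0) condition that reduces them to the frame.\<close>

lemma p0_form_eqI:
  assumes "is_p0 a b c p \<alpha>" "is_p0 a b c p \<beta>"
    and "\<And>g L. \<not> (length L = p \<and> set L \<subseteq> {1..6}) \<Longrightarrow> \<alpha> g L = 0"
    and "\<And>g L. \<not> (length L = p \<and> set L \<subseteq> {1..6}) \<Longrightarrow> \<beta> g L = 0"
    and "\<And>g K. length K = p \<Longrightarrow> set K \<subseteq> {1,2,3} \<Longrightarrow>
      eval_form \<alpha> g (map (frame10 a b c) K) = eval_form \<beta> g (map (frame10 a b c) K)"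
  shows "\<alpha> = \<beta>"
proof (intro ext)
  fix g L
  show "\<alpha> g L = \<beta> g L"
  proof (cases "length L = p \<and> set L \<subseteq> {1..6}")
    case True
    then show ?thesis
      using p0_eval_eqI[OF assms(1,2,5), of "[]" "map (\<lambda>i j. if j = i then 1 else 0) L" g]
      by (simp add: eval_form_units)
  qed (simp add: assms(3,4))
qed

text \<open>This is meant for the exterior derivative of a (p,0)-form, which may have a (p,1) part,
  so \<open>p0_slot_expand\<close> does not apply. Here every argument has a pure type and is
  expanded in the frame of that type.\<close>

lemma eval_form_T10_T01_zeroI:
  assumes base: "\<And>K k. length K = p \<Longrightarrow> set K \<subseteq> {1,2,3} \<Longrightarrow> k \<in> {1,2,3} \<Longrightarrow>
      eval_form \<beta> g (map (frame10 a b c) K @ [frame01 a b c k]) = 0"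
    and w: "w \<in> T01 a b c"
    and "length K + length vs = p" "set K \<subseteq> {1,2,3}" "set vs \<subseteq> T10 a b c"
  shows "eval_form \<beta> g (map (frame10 a b c) K @ vs @ [w]) = 0"
  using assms(3-5)
proof (induction vs arbitrary: K)
  case Nil
  then have "eval_form \<beta> g (map (frame10 a b c) K @ [frame01 a b c k]) = 0" if "k \<in> {1,2,3}" for k
    using base that by simp
  then show ?case
    using eval_form_slot_sum[where u = w and ys = "[]", OF T01_expand[OF w]] by simp
next
  case (Cons v vs)
  then have v: "v \<in> T10 a b c" by simp
  have "eval_form \<beta> g (map (frame10 a b c) K @ frame10 a b c k # vs @ [w]) = 0" if "k \<in> {1,2,3}" for k
    using Cons.IH[of "K @ [k]"] Cons.prems that by simp
  then show ?case
    using eval_form_slot_sum[where u = v and ys = "vs @ [w]", OF T10_expand[OF v]] by simp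
qed

text \<open>By multilinearity it suffices to test frame vectors. The sign (-1)^p of the Cartan
  formula cancels, and since a (p,0)-form sees only the (1,0) part of a bracket, \<open>conn\<close>
  contains all zeroth-order coefficients.\<close>

lemma dbar_closed_iff:
  assumes diff: "\<And>L g. (\<lambda>h. \<psi> h L) differentiable at g" and p0: "is_p0 a b c p \<psi>"
  shows "dbar_closed a b c p \<psi> \<longleftrightarrow>
    (\<forall>g K k. length K = p \<and> set K \<subseteq> {1,2,3} \<and> k \<in> {1,2,3} \<longrightarrow>
      dir_deriv (frame01 a b c k) (\<lambda>h. eval_form \<psi> h (map (frame10 a b c) K)) g +
      (\<Sum>j<p. (-1)^j * (\<Sum>m\<in>{1,2,3}. conn a c m (K!j) k *
          eval_form \<psi> g (map (frame10 a b c) (m # rem j K)))) = 0)"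
    (is "_ \<longleftrightarrow> (\<forall>g K k. ?adm K k \<longrightarrow> ?Q g K k = 0)")
proof -
  let ?V = "frame10 a b c" and ?W = "frame01 a b c"
  have key: "eval_form (dform \<psi>) g (map ?V K @ [?W k]) = (-1)^p * ?Q g K k" if adm: "?adm K k" for g K k
  proof -
    have "eval_form \<psi> g (bracket (?V (K!j)) (?W k) # rem j (map ?V K)) =
        (\<Sum>m\<in>{1,2,3}. conn a c m (K!j) k * eval_form \<psi> g (map ?V (m # rem j K)))" if j: "j < p" for j
    proof -
      have "K!j \<in> {1,2,3}" using adm j nth_mem by blast
      then show ?thesis
        using p0_slot_expand[OF p0, of "[]" "bracket (?V (K!j)) (?W k)" "rem j (map ?V K)" g] adm j
        by (simp add: apply1_phic_bracket[simplified] rem_map length_rem)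
    qed
    moreover have "?W k \<in> T01 a b c" using adm frame01_in_T01 by blast
    ultimately show ?thesis
      using eval_dform_p0[where vs = "map ?V K" and w = "?W k" and \<psi> = \<psi>, OF diff] adm p0 by simp
  qed
  have "dbar_closed a b c p \<psi> \<longleftrightarrow>
      (\<forall>g K k. ?adm K k \<longrightarrow> eval_form (dform \<psi>) g (map ?V K @ [?W k]) = 0)" (is "?L \<longleftrightarrow> ?R")
  proof
    assume ?L
    moreover have "set (map ?V K) \<subseteq> T10 a b c" if "set K \<subseteq> {1,2,3}" for K
      using that frame10_in_T10 by auto
    moreover have "length (map ?V K) = length K" for K by simp
    ultimately show ?R
      unfolding dbar_closed_def using frame01_in_T01 by blast
  next
    assume ?R
    then show ?L
      unfolding dbar_closed_def
      using eval_form_T10_T01_zeroI[where \<beta> = "dform \<psi>" and K = "[]" and p = p] by auto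
  qed
  then show ?thesis by (simp add: key)
qed

end

section \<open>Bounded solutions of Cauchy-Riemann equations\<close>

text \<open>\<open>A\<close> and \<open>B\<close> are the partial derivatives along Re and Im, so
  \<open>k\<close> is twice the derivative in conj z, and subtracting (k/2) conj z leaves an entire
  function of linear growth. By Liouville it is affine, so \<open>F\<close> is real-affine, and
  boundedness removes its linear part.\<close>

lemma bounded_constant_dbar:
  fixes F A B :: "complex \<Rightarrow> complex"
  assumes deriv: "\<And>z. (F has_derivative (\<lambda>d. of_real (Re d) * A z + of_real (Im d) * B z)) (at z)"
    and dbar: "\<And>z. A z + \<i> * B z = k"
    and bdd: "\<And>z. norm (F z) \<le> M"
  shows "k = 0 \<and> F z = F 0"
proof -
  define h where "h z = F z - k / 2 * cnj z" for z
  have "(h has_field_derivative (A z - k / 2)) (at z)" for z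
  proof -
    have B: "B z = - \<i> * k + \<i> * A z"
      using arg_cong[OF dbar[of z], of "\<lambda>w. - \<i> * w"] by (simp add: algebra_simps)
    have "(h has_derivative (\<lambda>d. (of_real (Re d) * A z + of_real (Im d) * B z) - k / 2 * cnj d)) (at z)"
      unfolding h_def by (intro has_derivative_diff deriv has_derivative_mult_right
          bounded_linear.has_derivative[OF bounded_linear_cnj] has_derivative_ident)
    moreover have "(of_real (Re d) * A z + of_real (Im d) * B z) - k / 2 * cnj d = (A z - k / 2) * d" for d
    proof -
      have d: "d = of_real (Re d) + \<i> * of_real (Im d)" "cnj d = of_real (Re d) - \<i> * of_real (Im d)"
        by (auto simp: complex_eq_iff)
      show ?thesis
        unfolding B by (subst (3) d(1), subst d(2)) (simp add: algebra_simps)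
    qed
    ultimately show ?thesis by (simp add: has_field_derivative_def)
  qed
  then have hol: "h holomorphic_on UNIV"
    by (auto simp: holomorphic_on_def field_differentiable_def intro: DERIV_subset)
  have M0: "0 \<le> M" using norm_ge_zero bdd[of 0] by (rule order_trans)
  have growth: "norm (h z) \<le> (M + norm k) * norm z ^ 1" if "1 \<le> norm z" for z
  proof -
    have "norm (h z) \<le> norm (F z) + norm (k / 2 * cnj z)" unfolding h_def by (rule norm_triangle_ineq4)
    also have "\<dots> \<le> M + norm k * norm z"
      using bdd[of z] by (intro add_mono) (auto simp: norm_mult norm_divide)
    also have "\<dots> \<le> M * norm z + norm k * norm z"
      using mult_left_mono[OF that M0] by simp
    finally show ?thesis by (simp add: algebra_simps)
  qed
  have h: "h z = h 0 + deriv h 0 * z" for z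
    using Liouville_polynomial[OF hol growth, where \<xi> = z] by simp
  define \<beta> where "\<beta> = deriv h 0"
  have F: "F z = F 0 + \<beta> * z + k / 2 * cnj z" for z
    using h[of z] by (simp add: h_def \<beta>_def algebra_simps)
  \<comment> \<open>A real line spanned by \<open>w\<close> stays bounded only if \<open>w\<close>
    is zero; otherwise the chosen scale reaches norm 2M + 1.\<close>
  have lin: "w = 0" if w: "\<And>r::real. norm (w * of_real r) \<le> 2 * M" for w :: complex
  proof (rule ccontr)
    assume "w \<noteq> 0"
    then have "norm (w * of_real ((2 * M + 1) / norm w)) = 2 * M + 1"
      using M0 by (simp add: norm_mult norm_divide del: of_real_divide)
    with w[of "(2 * M + 1) / norm w"] show False by simp
  qed
  have diff: "norm (F z - F 0) \<le> 2 * M" for z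
    using norm_triangle_ineq4[of "F z" "F 0"] bdd[of z] bdd[of 0] by simp
  \<comment> \<open>The slopes of \<open>F\<close> along the real and imaginary axes are \<beta> +
    k/2 and i (\<beta> - k/2). Both vanish, hence so do \<beta> and \<open>k\<close>.\<close>
  have "\<beta> + k / 2 = 0"
  proof (rule lin)
    fix r :: real
    show "norm ((\<beta> + k / 2) * of_real r) \<le> 2 * M"
      using diff[of "of_real r"] F[of "of_real r"] by (simp add: algebra_simps)
  qed
  moreover have "\<i> * (\<beta> - k / 2) = 0"
  proof (rule lin)
    fix r :: real
    show "norm (\<i> * (\<beta> - k / 2) * of_real r) \<le> 2 * M"
      using diff[of "\<i> * of_real r"] F[of "\<i> * of_real r"] by (simp add: algebra_simps)
  qed
  ultimately have "\<beta> = 0" "k = 0" by (auto simp: add_eq_0_iff2)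
  then show ?thesis using F[of z] by simp
qed

text \<open>Pulling \<open>f\<close> back along the affine map z -> g + Re z p + Im z q turns D_p +
  i D_q into the Cauchy-Riemann operator of the complex plane.\<close>

lemma bounded_constant_dbar_plane:
  fixes f :: "'a::real_normed_vector \<Rightarrow> complex" and p q g :: 'a
  assumes deriv: "\<And>h. (f has_derivative f' h) (at h)"
    and dbar: "\<And>r s. f' (g + r *\<^sub>R p + s *\<^sub>R q) p + \<i> * f' (g + r *\<^sub>R p + s *\<^sub>R q) q = k"
    and bdd: "\<And>r s. norm (f (g + r *\<^sub>R p + s *\<^sub>R q)) \<le> M"
  shows "k = 0 \<and> f (g + r *\<^sub>R p + s *\<^sub>R q) = f g"
proof -
  let ?l = "\<lambda>z. g + Re z *\<^sub>R p + Im z *\<^sub>R q"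
  have "((\<lambda>z. f (?l z)) has_derivative (\<lambda>d. of_real (Re d) * f' (?l z) p + of_real (Im d) * f' (?l z) q)) (at z)" for z
  proof -
    have "(?l has_derivative (\<lambda>d. Re d *\<^sub>R p + Im d *\<^sub>R q)) (at z)"
      by (auto intro!: derivative_eq_intros)
    from diff_chain_at[OF this deriv] have
      "((\<lambda>z. f (?l z)) has_derivative (\<lambda>d. f' (?l z) (Re d *\<^sub>R p + Im d *\<^sub>R q))) (at z)"
      by (simp add: o_def)
    moreover have "linear (f' (?l z))" using deriv has_derivative_linear by blast
    ultimately show ?thesis
      by (simp add: linear_add linear_scale scaleR_conv_of_real)
  qed
  from bounded_constant_dbar[OF this dbar bdd, of "Complex r s"] show ?thesis by simp
qed

section \<open>Boundedness from lattice periodicity\<close>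

lemma bounded_image_compactI:
  fixes f :: "'a::topological_space \<Rightarrow> complex" and \<sigma> :: "'b::topological_space \<Rightarrow> 'a"
  assumes "continuous_on UNIV f" "continuous_on K \<sigma>" "compact K"
    and "\<And>x. x \<in> S \<Longrightarrow> \<exists>\<theta>\<in>K. f x = f (\<sigma> \<theta>)"
  obtains M where "\<And>x. x \<in> S \<Longrightarrow> norm (f x) \<le> M"
proof -
  have "continuous_on K (\<lambda>\<theta>. f (\<sigma> \<theta>))"
    using continuous_on_compose2[OF assms(1,2)] by auto
  then have "bounded ((\<lambda>\<theta>. f (\<sigma> \<theta>)) ` K)"
    using assms(3) compact_continuous_image compact_imp_bounded by blast
  then obtain M where "\<And>\<theta>. \<theta> \<in> K \<Longrightarrow> norm (f (\<sigma> \<theta>)) \<le> M"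
    by (auto simp: bounded_iff)
  then show thesis using assms(4) that by metis
qed

text \<open>The witnesses are the integer and fractional parts of the coordinates of y in the basis
  of columns of \<open>P\<close>. Closed intervals are used so that the cell is compact.\<close>

lemma lattice_fundamental_domain:
  fixes P :: "real^2^2"
  assumes "invertible P"
  obtains m1 m2 :: int and \<theta>1 \<theta>2 :: real where "\<theta>1 \<in> {0..1}" "\<theta>2 \<in> {0..1}"
    "y1 = (of_int m1 * P$1$1 + of_int m2 * P$1$2) + (\<theta>1 * P$1$1 + \<theta>2 * P$1$2)"
    "y2 = (of_int m1 * P$2$1 + of_int m2 * P$2$2) + (\<theta>1 * P$2$1 + \<theta>2 * P$2$2)"
proof -
  let ?y = "vector [y1, y2] :: real^2"
  obtain Q where "P ** Q = mat 1" using assms unfolding invertible_def by blast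
  define v where "v = Q *v ?y"
  have "P *v v = ?y"
    unfolding v_def by (simp add: matrix_vector_mul_assoc \<open>P ** Q = mat 1\<close>)
  then have "(P *v v) $ 1 = y1" "(P *v v) $ 2 = y2" by simp_all
  then have y: "y1 = P$1$1 * v$1 + P$1$2 * v$2" "y2 = P$2$1 * v$1 + P$2$2 * v$2"
    by (simp_all add: matrix_vector_mult_def sum_2)
  show thesis
    by (rule that[of "frac (v$1)" "frac (v$2)" "\<lfloor>v$1\<rfloor>" "\<lfloor>v$2\<rfloor>"])
       (use frac_lt_1[of "v$1"] frac_lt_1[of "v$2"] in \<open>simp_all add: y less_imp_le\<close>,
        simp_all add: frac_def algebra_simps)
qed

lemma lattice_baseI: "(a0 * of_int k, of_int n, 0, 0, 0, 0) \<in> lattice a0 P"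
proof -
  have "\<exists>m1 m2 :: int. 0 = of_int m1 * P$1$1 + of_int m2 * P$1$2 \<and> 0 = of_int m1 * P$2$1 + of_int m2 * P$2$2"
    by (intro exI[of _ 0]) simp
  then show ?thesis unfolding lattice_def by blast
qed

definition constant_on_fibres :: "(pt \<Rightarrow> complex) \<Rightarrow> bool" where
  "constant_on_fibres f \<longleftrightarrow> (\<forall>t x y1 y2 z1 z2. f (t,x,y1,y2,z1,z2) = f (t,x,0,0,0,0))"

definition invariant_diff :: "real \<Rightarrow> real^2^2 \<Rightarrow> (pt \<Rightarrow> complex) \<Rightarrow> bool" where
  "invariant_diff a0 P f \<longleftrightarrow>
     (\<forall>g. f differentiable at g) \<and> (\<forall>\<gamma>\<in>lattice a0 P. \<forall>g. f (gmul \<gamma> g) = f g)"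

lemma invariant_diff_continuous: "invariant_diff a0 P f \<Longrightarrow> continuous_on UNIV f"
  unfolding invariant_diff_def
  by (meson continuous_at_imp_continuous_on differentiable_imp_continuous_within)

text \<open>Lattice elements with t = x = 0 act on a fibre by ordinary translation, so every fibre
  point can be moved into the compact cell spanned by the columns of \<open>P\<close> in both the y
  and the z plane.\<close>

lemma fibre_bounded:
  assumes "invertible P" and f: "invariant_diff a0 P f"
  obtains M where "\<And>y1 y2 z1 z2. norm (f (t,x,y1,y2,z1,z2)) \<le> M"
proof -
  let ?K = "{0..1::real} \<times> {0..1::real} \<times> {0..1::real} \<times> {0..1::real}"
  let ?\<sigma> = "\<lambda>(\<theta>1,\<theta>2,\<eta>1,\<eta>2). (t, x, \<theta>1 * P$1$1 + \<theta>2 * P$1$2, \<theta>1 * P$2$1 + \<theta>2 * P$2$2,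
     \<eta>1 * P$1$1 + \<eta>2 * P$1$2, \<eta>1 * P$2$1 + \<eta>2 * P$2$2)"
  have cover: "\<exists>\<theta>\<in>?K. f h = f (?\<sigma> \<theta>)" if "h \<in> {(t,x,y1,y2,z1,z2) |y1 y2 z1 z2. True}" for h
  proof -
    from that obtain y1 y2 z1 z2 where h: "h = (t,x,y1,y2,z1,z2)" by auto
    obtain m1 m2 \<theta>1 \<theta>2 where \<theta>: "\<theta>1 \<in> {0..1}" "\<theta>2 \<in> {0..1}"
      and y: "y1 = (of_int m1 * P$1$1 + of_int m2 * P$1$2) + (\<theta>1 * P$1$1 + \<theta>2 * P$1$2)"
        "y2 = (of_int m1 * P$2$1 + of_int m2 * P$2$2) + (\<theta>1 * P$2$1 + \<theta>2 * P$2$2)"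
      by (rule lattice_fundamental_domain[OF assms(1)])
    obtain n1 n2 \<eta>1 \<eta>2 where \<eta>: "\<eta>1 \<in> {0..1}" "\<eta>2 \<in> {0..1}"
      and z: "z1 = (of_int n1 * P$1$1 + of_int n2 * P$1$2) + (\<eta>1 * P$1$1 + \<eta>2 * P$1$2)"
        "z2 = (of_int n1 * P$2$1 + of_int n2 * P$2$2) + (\<eta>1 * P$2$1 + \<eta>2 * P$2$2)"
      by (rule lattice_fundamental_domain[OF assms(1)])
    let ?\<gamma> = "(0, 0, of_int m1 * P$1$1 + of_int m2 * P$1$2, of_int m1 * P$2$1 + of_int m2 * P$2$2,
        of_int n1 * P$1$1 + of_int n2 * P$1$2, of_int n1 * P$2$1 + of_int n2 * P$2$2) :: pt"
    have "?\<gamma> \<in> lattice a0 P" by (auto simp: lattice_def)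
    moreover have "h = gmul ?\<gamma> (?\<sigma> (\<theta>1,\<theta>2,\<eta>1,\<eta>2))" by (simp add: h y z gmul_def)
    ultimately have "f h = f (?\<sigma> (\<theta>1,\<theta>2,\<eta>1,\<eta>2))"
      using f unfolding invariant_diff_def by (simp only:)
    moreover have "(\<theta>1,\<theta>2,\<eta>1,\<eta>2) \<in> ?K" using \<theta> \<eta> by simp
    ultimately show ?thesis by blast
  qed
  have cont: "continuous_on ?K ?\<sigma>"
    unfolding case_prod_beta by (intro continuous_intros)
  have comp: "compact ?K" by (intro compact_Times compact_Icc)
  obtain M where "\<And>h. h \<in> {(t,x,y1,y2,z1,z2) |y1 y2 z1 z2. True} \<Longrightarrow> norm (f h) \<le> M"
    using bounded_image_compactI[OF invariant_diff_continuous[OF f] cont comp cover] by blast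
  then show thesis using that by blast
qed

text \<open>Lattice elements without fibre part shift t by multiples of \<open>a0\<close> and x by
  integers. As \<open>f\<close> ignores the fibre, all its values occur on one compact
  rectangle.\<close>

lemma base_bounded:
  assumes "a0 > 0" and f: "invariant_diff a0 P f" and fib: "constant_on_fibres f"
  obtains M where "\<And>g. norm (f g) \<le> M"
proof -
  let ?K = "{0..1::real} \<times> {0..1::real}"
  let ?\<sigma> = "\<lambda>(\<theta>,\<eta>). (a0 * \<theta>, \<eta>, 0, 0, 0, 0) :: pt"
  have cover: "\<exists>\<theta>\<in>?K. f h = f (?\<sigma> \<theta>)" if "h \<in> UNIV" for h
  proof -
    obtain t x y1 y2 z1 z2 where h: "h = (t,x,y1,y2,z1,z2)" by (cases h)
    let ?\<theta> = "frac (t / a0)" and ?\<eta> = "frac x"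
    let ?\<gamma> = "(a0 * of_int \<lfloor>t / a0\<rfloor>, of_int \<lfloor>x\<rfloor>, 0, 0, 0, 0) :: pt"
    have "?\<gamma> \<in> lattice a0 P" by (rule lattice_baseI)
    then have "f (gmul ?\<gamma> (?\<sigma> (?\<theta>,?\<eta>))) = f (?\<sigma> (?\<theta>,?\<eta>))"
      using f unfolding invariant_diff_def by blast
    moreover have "gmul ?\<gamma> (?\<sigma> (?\<theta>,?\<eta>)) = (t,x,0,0,0,0)"
      using assms(1) by (simp add: gmul_def frac_def algebra_simps)
    moreover have "f h = f (t,x,0,0,0,0)" using fib h unfolding constant_on_fibres_def by blast
    moreover have "(?\<theta>,?\<eta>) \<in> ?K" unfolding mem_Times_iff by (auto intro: less_imp_le[OF frac_lt_1])
    ultimately have "f h = f (?\<sigma> (?\<theta>,?\<eta>))" by (simp only:)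
    then show ?thesis using \<open>(?\<theta>,?\<eta>) \<in> ?K\<close> by (rule bexI)
  qed
  have cont: "continuous_on ?K ?\<sigma>"
    unfolding case_prod_beta by (intro continuous_intros)
  have comp: "compact ?K" by (intro compact_Times compact_Icc)
  obtain M where "\<And>h. h \<in> UNIV \<Longrightarrow> norm (f h) \<le> M"
    using bounded_image_compactI[OF invariant_diff_continuous[OF f] cont comp cover] by blast
  then show thesis using that by blast
qed

section \<open>The conjugate frame as Cauchy-Riemann operators\<close>

text \<open>Splitting 2 conj V_k as D_p + i D_q with real fields p and q gives the shape required by
  \<open>bounded_constant_dbar_plane\<close>. For k = 3 the b-term goes into q.\<close>

lemma dir_deriv_frame01:
  assumes "(f has_derivative f') (at g)"
  shows "2 * dir_deriv (frame01 a b c 1) f g = f' ((1 / a) *\<^sub>R Evec 1 g) + \<i> * f' (Evec 2 g)"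
    "2 * dir_deriv (frame01 a b c 2) f g = f' ((1 / c) *\<^sub>R Evec 3 g) + \<i> * f' (Evec 6 g)"
    "2 * dir_deriv (frame01 a b c 3) f g =
       f' ((1 / c) *\<^sub>R Evec 4 g) + \<i> * f' (Evec 5 g - (b / c) *\<^sub>R Evec 3 g)"
proof -
  have lin: "linear f'" using assms by (rule has_derivative_linear)
  have E: "Eder i f g = f' (Evec i g)" for i
    unfolding Eder_def using frechet_derivative_at[OF assms] by simp
  show "2 * dir_deriv (frame01 a b c 1) f g = f' ((1 / a) *\<^sub>R Evec 1 g) + \<i> * f' (Evec 2 g)"
    "2 * dir_deriv (frame01 a b c 2) f g = f' ((1 / c) *\<^sub>R Evec 3 g) + \<i> * f' (Evec 6 g)"
    "2 * dir_deriv (frame01 a b c 3) f g =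
       f' ((1 / c) *\<^sub>R Evec 4 g) + \<i> * f' (Evec 5 g - (b / c) *\<^sub>R Evec 3 g)"
    unfolding dir_deriv_def sum_1_6 E linear_diff[OF lin] linear_scale[OF lin] scaleR_conv_of_real
    by (simp_all add: frame01_def frame10_def algebra_simps)
qed

text \<open>The real directions in conj V_2 and conj V_3 span two planes that together fill the
  fibre, and the Liouville argument is applied in each. Admitting constants \<open>k2\<close> and
  \<open>k3\<close> as right-hand sides lets later arguments conclude that these vanish.\<close>

lemma dbar_constant_along_fibre:
  assumes "c \<noteq> 0" "invertible P" and f: "invariant_diff a0 P f"
    and k2: "\<And>y1 y2 z1 z2. dir_deriv (frame01 a b c 2) f (t,x,y1,y2,z1,z2) = k2"
    and k3: "\<And>y1 y2 z1 z2. dir_deriv (frame01 a b c 3) f (t,x,y1,y2,z1,z2) = k3"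
  shows "k2 = 0 \<and> k3 = 0 \<and> f (t,x,y1,y2,z1,z2) = f (t,x,0,0,0,0)"
proof -
  obtain M where M: "\<And>y1 y2 z1 z2. norm (f (t,x,y1,y2,z1,z2)) \<le> M"
    using fibre_bounded[OF assms(2) f] by blast
  define f' where "f' h = frechet_derivative f (at h)" for h
  have deriv: "(f has_derivative f' h) (at h)" for h
    using f unfolding invariant_diff_def f'_def frechet_derivative_works by blast
  let ?g = "(t,x,0,0,0,0) :: pt"
  let ?p2 = "(1 / c) *\<^sub>R Evec 3 ?g" and ?q2 = "Evec 6 ?g"
  let ?p3 = "(1 / c) *\<^sub>R Evec 4 ?g" and ?q3 = "Evec 5 ?g - (b / c) *\<^sub>R Evec 3 ?g"
  \<comment> \<open>The frame depends on (t,x) only, so along a fibre p and q are constant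
    vectors.\<close>
  have E: "Evec i (t,x,y1,y2,z1,z2) = Evec i ?g" for i y1 y2 z1 z2
    by (simp add: Evec_def)
  have Eg: "Evec 3 ?g = (0,0,exp t,0,0,0)" "Evec 4 ?g = (0,0,0,exp (-t),0,0)"
    "Evec 5 ?g = (0,0,x * exp t,0,exp t,0)" "Evec 6 ?g = (0,0,0,x * exp (-t),0,exp (-t))"
    by (simp_all add: Evec_def)
  have exp_cancel: "exp t * (exp (-t) * v) = v" "exp (-t) * (exp t * v) = v" for v :: real
    by (simp_all add: exp_minus)
  have plane2: "2 * k2 = 0 \<and> f ((t,x,y1,y2,z1,z2) + r *\<^sub>R ?p2 + s *\<^sub>R ?q2) = f (t,x,y1,y2,z1,z2)"
    for r s y1 y2 z1 z2
  proof (rule bounded_constant_dbar_plane[OF deriv, where M = M])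
    fix r s
    let ?y1 = "y1 + r / c * exp t" and ?y2 = "y2 + s * x * exp (-t)"
    let ?z1 = "z1" and ?z2 = "z2 + s * exp (-t)"
    let ?h = "(t, x, ?y1, ?y2, ?z1, ?z2)"
    have h: "(t,x,y1,y2,z1,z2) + r *\<^sub>R ?p2 + s *\<^sub>R ?q2 = ?h"
      unfolding Eg by (simp add: algebra_simps)
    show "f' ((t,x,y1,y2,z1,z2) + r *\<^sub>R ?p2 + s *\<^sub>R ?q2) ?p2 +
        \<i> * f' ((t,x,y1,y2,z1,z2) + r *\<^sub>R ?p2 + s *\<^sub>R ?q2) ?q2 = 2 * k2"
      unfolding h using dir_deriv_frame01(2)[OF deriv, of a b c ?h]
      by (simp only: E[of _ ?y1 ?y2 ?z1 ?z2] k2)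
    show "norm (f ((t,x,y1,y2,z1,z2) + r *\<^sub>R ?p2 + s *\<^sub>R ?q2)) \<le> M" unfolding h by (rule M)
  qed
  have plane3: "2 * k3 = 0 \<and> f ((t,x,y1,y2,z1,z2) + r *\<^sub>R ?p3 + s *\<^sub>R ?q3) = f (t,x,y1,y2,z1,z2)"
    for r s y1 y2 z1 z2
  proof (rule bounded_constant_dbar_plane[OF deriv, where M = M])
    fix r s
    let ?y1 = "y1 + s * (x - b / c) * exp t" and ?y2 = "y2 + r / c * exp (-t)"
    let ?z1 = "z1 + s * exp t" and ?z2 = "z2"
    let ?h = "(t, x, ?y1, ?y2, ?z1, ?z2)"
    have h: "(t,x,y1,y2,z1,z2) + r *\<^sub>R ?p3 + s *\<^sub>R ?q3 = ?h"
      unfolding Eg by (simp add: algebra_simps)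
    show "f' ((t,x,y1,y2,z1,z2) + r *\<^sub>R ?p3 + s *\<^sub>R ?q3) ?p3 +
        \<i> * f' ((t,x,y1,y2,z1,z2) + r *\<^sub>R ?p3 + s *\<^sub>R ?q3) ?q3 = 2 * k3"
      unfolding h using dir_deriv_frame01(3)[OF deriv, of a b c ?h]
      by (simp only: E[of _ ?y1 ?y2 ?z1 ?z2] k3)
    show "norm (f ((t,x,y1,y2,z1,z2) + r *\<^sub>R ?p3 + s *\<^sub>R ?q3)) \<le> M" unfolding h by (rule M)
  qed
  \<comment> \<open>In the plane of conj V_2, \<open>s2\<close> removes z2 at the cost of x z2 in
    y2, and \<open>r2\<close> brings y1 to (x - b/c) z1. The remaining point lies in the plane of
    conj V_3 through the fibre origin.\<close>
  define r2 where "r2 = c * exp (-t) * (y1 - (x - b / c) * z1)"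
  define s2 where "s2 = exp t * z2"
  have "(t,x,y1,y2,z1,z2) = (t, x, (x - b / c) * z1, y2 - x * z2, z1, 0) + r2 *\<^sub>R ?p2 + s2 *\<^sub>R ?q2"
    using assms(1) unfolding Eg r2_def s2_def by (simp add: exp_cancel mult.commute[of _ "exp t"] flip: exp_add)
  then have "f (t,x,y1,y2,z1,z2) = f (t, x, (x - b / c) * z1, y2 - x * z2, z1, 0)"
    by (simp only: conjunct2[OF plane2])
  also have "(t, x, (x - b / c) * z1, y2 - x * z2, z1, 0) =
      ?g + (c * exp t * (y2 - x * z2)) *\<^sub>R ?p3 + (exp (-t) * z1) *\<^sub>R ?q3"
    using assms(1) unfolding Eg by (simp add: algebra_simps flip: exp_add)
  also have "f \<dots> = f ?g" by (rule conjunct2[OF plane3])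
  finally show ?thesis using plane2 plane3 by simp
qed

text \<open>Multiplying by \<open>exp (\<i> * \<kappa> * x)\<close> turns the twisted equation into the Cauchy-Riemann equation in the
  variable \<open>a * t + \<i> * x\<close>.\<close>
lemma twisted_dbar_on_base:
  assumes "a \<noteq> 0" "a0 > 0" and f: "invariant_diff a0 P f" and fib: "constant_on_fibres f"
    and dbar: "\<And>g. dir_deriv (frame01 a b c 1) f g = of_real (\<kappa> / 2) * f g"
  shows "f (t,x,y1,y2,z1,z2) = f 0 * exp (- \<i> * of_real (\<kappa> * x))"
    and "f 0 * exp (\<i> * of_real \<kappa>) = f 0"
proof -
  obtain M where M: "\<And>g. norm (f g) \<le> M"
    using base_bounded[OF assms(2) f fib] by blast
  define f' where "f' h = frechet_derivative f (at h)" for h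
  have deriv: "(f has_derivative f' h) (at h)" for h
    using f unfolding invariant_diff_def f'_def frechet_derivative_works by blast
  let ?e = "\<lambda>g::pt. exp (\<i> * of_real (\<kappa> * fst (snd g)))"
  define w where "w g = f g * ?e g" for g
  define w' where "w' g d = f g * (?e g * (\<i> * of_real (\<kappa> * fst (snd d)))) + f' g d * ?e g" for g d
  have we: "(w has_derivative w' g) (at g)" for g
  proof -
    have "((\<lambda>g::pt. \<i> * of_real (\<kappa> * fst (snd g))) has_derivative (\<lambda>d. \<i> * of_real (\<kappa> * fst (snd d)))) (at g)"
      by (auto intro!: derivative_eq_intros)
    from has_derivative_mult[OF deriv
        has_derivative_compose[OF this has_field_derivative_imp_has_derivative[OF DERIV_exp]]]
    show ?thesis unfolding w_def w'_def .
  qed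
  let ?p = "(1 / a) *\<^sub>R (1,0,0,0,0,0) :: pt" and ?q = "(0,1,0,0,0,0) :: pt"
  have const: "w ((t,x,0,0,0,0)) = w 0" for t x
  proof -
    \<comment> \<open>The first direction is scaled by 1/a, so the parameter a t reaches first
      coordinate t.\<close>
    have "(0::complex) = 0 \<and> w (0 + (a * t) *\<^sub>R ?p + x *\<^sub>R ?q) = w 0"
    proof (rule bounded_constant_dbar_plane[OF we, where M = M])
      fix r s
      let ?h = "0 + r *\<^sub>R ?p + s *\<^sub>R ?q :: pt"
      have "Evec 1 ?h = (1,0,0,0,0,0)" "Evec 2 ?h = (0,1,0,0,0,0)"
        by (simp_all add: Evec_def case_prod_beta)
      then have "f' ?h ?p + \<i> * f' ?h ?q = of_real \<kappa> * f ?h"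
        using dir_deriv_frame01(1)[OF deriv, of a b c ?h] by (simp only: dbar) simp
      then have "f' ?h ?p = of_real \<kappa> * f ?h - \<i> * f' ?h ?q" by (simp add: algebra_simps)
      \<comment> \<open>Only the second direction changes x. There i times the factor i \<kappa>
        from the exponential is -\<kappa>, which cancels the right-hand side.\<close>
      moreover have "fst (snd ?p) = 0" "fst (snd ?q) = 1" by simp_all
      ultimately show "w' ?h ?p + \<i> * w' ?h ?q = 0"
        unfolding w'_def by (simp only:) (simp add: algebra_simps)
      have "norm (w ?h) = norm (f ?h)" unfolding w_def norm_mult by simp
      then show "norm (w ?h) \<le> M" using M by simp
    qed
    then show ?thesis using assms(1) by (simp add: zero_prod_def)
  qed
  have "w 0 = f 0" by (simp add: w_def)
  then have "f (t,x,0,0,0,0) * exp (\<i> * of_real (\<kappa> * x)) = f 0" for t x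
    using const[of t x] by (simp add: w_def)
  from arg_cong[OF this, of "\<lambda>u. u * exp (- (\<i> * of_real (\<kappa> * x)))" t x for t x]
  have sol: "f (t,x,0,0,0,0) = f 0 * exp (- \<i> * of_real (\<kappa> * x))" for t x
    by (simp add: mult.assoc flip: exp_add)
  then show "f (t,x,y1,y2,z1,z2) = f 0 * exp (- \<i> * of_real (\<kappa> * x))"
    using fib unfolding constant_on_fibres_def by metis
  \<comment> \<open>This lattice element carries the identity to x = -1, where the solution formula
    gives f(0) exp(i \<kappa>); invariance equates that with f(0).\<close>
  have "(0,-1,0,0,0,0) \<in> lattice a0 P"
    using lattice_baseI[of a0 0 "-1"] by simp
  then have "f (gmul (0,-1,0,0,0,0) 0) = f 0"
    using f unfolding invariant_diff_def by blast
  moreover have "gmul (0,-1,0,0,0,0) 0 = (0,-1,0,0,0,0)" by (simp add: gmul_def zero_prod_def)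
  ultimately show "f 0 * exp (\<i> * of_real \<kappa>) = f 0" using sol[of 0 "-1"] by simp
qed

section \<open>Left-invariant forms and plane waves\<close>

definition wave :: "real \<Rightarrow> pt \<Rightarrow> complex" where
  "wave \<kappa> g = exp (\<i> * of_real (\<kappa> * fst (snd g)))"

lemma wave_zero_freq [simp]: "wave 0 g = 1"
  by (simp add: wave_def)

lemma wave_at_0 [simp]: "wave \<kappa> 0 = 1"
  by (simp add: wave_def)

lemma has_derivative_wave:
  "(wave \<kappa> has_derivative (\<lambda>d. wave \<kappa> g * (\<i> * of_real (\<kappa> * fst (snd d))))) (at g)"
proof -
  have "((\<lambda>g::pt. \<i> * of_real (\<kappa> * fst (snd g))) has_derivative (\<lambda>d. \<i> * of_real (\<kappa> * fst (snd d)))) (at g)"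
    by (auto intro!: derivative_eq_intros)
  from has_derivative_compose[OF this has_field_derivative_imp_has_derivative[OF DERIV_exp]]
  show ?thesis unfolding wave_def .
qed

lemma has_derivative_wave_sum:
  "((\<lambda>g. A * wave \<kappa> g + B * wave (-\<kappa>) g) has_derivative
     (\<lambda>d. A * (wave \<kappa> g * (\<i> * of_real (\<kappa> * fst (snd d)))) +
          B * (wave (-\<kappa>) g * (\<i> * of_real (-\<kappa> * fst (snd d)))))) (at g)"
  by (intro has_derivative_add has_derivative_mult_right has_derivative_wave)

text \<open>A directional derivative only changes the two constants, so the family is closed under
  differentiation; hence the induction with arbitrary \<open>A\<close> and \<open>B\<close>.\<close>

lemma smooth_wave_sum: "smooth_fun (\<lambda>g. A * wave \<kappa> g + B * wave (-\<kappa>) g)"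
proof -
  have "Ck k (\<lambda>g. A * wave \<kappa> g + B * wave (-\<kappa>) g)" for k
  proof (induction k arbitrary: A B)
    case 0
    show ?case
      unfolding Ck.simps using has_derivative_wave_sum
      by (intro has_derivative_continuous_on) blast
  next
    case (Suc k)
    have "frechet_derivative (\<lambda>g. A * wave \<kappa> g + B * wave (-\<kappa>) g) (at g) v =
        (A * (\<i> * of_real (\<kappa> * fst (snd v)))) * wave \<kappa> g +
        (B * (\<i> * of_real (-\<kappa> * fst (snd v)))) * wave (-\<kappa>) g" for g v
      using frechet_derivative_at[OF has_derivative_wave_sum[of A \<kappa> B g]]
      by (auto simp: mult_ac dest!: fun_cong[where x = v])
    moreover have "(\<lambda>g. A * wave \<kappa> g + B * wave (-\<kappa>) g) differentiable at g" for g
      using has_derivative_wave_sum differentiableI by blast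
    ultimately show ?case using Suc by (simp only: Ck.simps) blast
  qed
  then show ?thesis by (simp add: smooth_fun_def)
qed

lemma smooth_const: "smooth_fun (\<lambda>g::pt. A :: complex)"
  using smooth_wave_sum[of A 0 0] by simp

text \<open>Waves depend on x alone, and E_2 occurs only in conj V_1, with coefficient i/2. Together
  with the factor i \<kappa> this gives -\<kappa>/2, and the opposite sign for the opposite
  frequency.\<close>

lemma dir_deriv_wave_sum:
  "dir_deriv (frame01 a b c k) (\<lambda>g. A * wave \<kappa> g + B * wave (-\<kappa>) g) g =
     (if k = 1 then of_real (\<kappa> / 2) * (B * wave (-\<kappa>) g - A * wave \<kappa> g) else 0)"
proof -
  have "Eder i (\<lambda>g. A * wave \<kappa> g + B * wave (-\<kappa>) g) g =
      A * (wave \<kappa> g * (\<i> * of_real (\<kappa> * fst (snd (Evec i g))))) +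
      B * (wave (-\<kappa>) g * (\<i> * of_real (-\<kappa> * fst (snd (Evec i g)))))" for i
    unfolding Eder_def
    using frechet_derivative_at[OF has_derivative_wave_sum[of A \<kappa> B g]]
    by (auto dest!: fun_cong[where x = "Evec i g"])
  moreover have "fst (snd (Evec i g)) = (if i = 2 then 1 else 0)" for i
    by (simp add: Evec_def case_prod_beta)
  ultimately have "Eder i (\<lambda>g. A * wave \<kappa> g + B * wave (-\<kappa>) g) g =
      (if i = 2 then \<i> * of_real \<kappa> * (A * wave \<kappa> g - B * wave (-\<kappa>) g) else 0)" for i
    by (simp only:) (simp add: algebra_simps)
  then show ?thesis
    unfolding dir_deriv_def sum_1_6 by (simp add: frame01_def frame10_def algebra_simps)
qed

text \<open>The coordinate x is additive under \<open>gmul\<close> and integral on the lattice,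
  while \<kappa> is an integer multiple of 2 pi.\<close>

lemma wave_lattice_invariant:
  assumes "exp (\<i> * of_real \<kappa>) = 1" "\<gamma> \<in> lattice a0 P"
  shows "wave \<kappa> (gmul \<gamma> g) = wave \<kappa> g"
proof -
  from assms(2) obtain n :: int where n: "fst (snd \<gamma>) = of_int n"
    unfolding lattice_def by auto
  from assms(1) obtain m :: int where m: "\<kappa> = of_int (2 * m) * pi"
    by (auto simp: exp_eq_1)
  have "exp (\<i> * of_real (\<kappa> * of_int n)) = 1"
    unfolding exp_eq_1 m by (auto intro!: exI[of _ "m * n"])
  moreover have "fst (snd (gmul \<gamma> g)) = of_int n + fst (snd g)"
    using n by (simp add: gmul_def case_prod_beta)
  ultimately show ?thesis
    by (simp add: wave_def distrib_left exp_add)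
qed

section \<open>Coefficient functions of forms on the quotient\<close>

lemma form_on_XD:
  assumes "form_on_X a0 P p \<psi>"
  shows "\<not> (length L = p \<and> set L \<subseteq> {1..6}) \<Longrightarrow> \<psi> g L = 0"
    and "i < length L \<Longrightarrow> j < length L \<Longrightarrow> i \<noteq> j \<Longrightarrow> \<psi> g (swap_pos i j L) = - \<psi> g L"
    and "smooth_fun (\<lambda>g. \<psi> g L)"
    and "\<gamma> \<in> lattice a0 P \<Longrightarrow> \<psi> (gmul \<gamma> g) L = \<psi> g L"
  using assms unfolding form_on_X_def by blast+

lemma form_on_X_differentiable: "form_on_X a0 P p \<psi> \<Longrightarrow> (\<lambda>h. \<psi> h L) differentiable at g"
  using form_on_XD(3)[of a0 P p \<psi> L] unfolding smooth_fun_def using Ck.simps(2)[of 0] by blast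

lemma form_on_X_eval_invariant:
  assumes "form_on_X a0 P p \<psi>"
  shows "invariant_diff a0 P (\<lambda>g. eval_form \<psi> g vs)"
proof -
  have "(\<lambda>g. eval_form \<psi> g vs) differentiable at g" for g
    using has_derivative_eval_form[of \<psi> g vs] form_on_X_differentiable[OF assms] differentiableI by blast
  moreover have "eval_form \<psi> (gmul \<gamma> g) vs = eval_form \<psi> g vs" if "\<gamma> \<in> lattice a0 P" for \<gamma> g
    unfolding eval_form_def by (simp add: form_on_XD(4)[OF assms that])
  ultimately show ?thesis by (simp add: invariant_diff_def)
qed

lemma form_on_X_swap:
  assumes "form_on_X a0 P p \<psi>"
  shows "eval_form \<psi> g (xs @ u # v # ys) = - eval_form \<psi> g (xs @ v # u # ys)"
proof (rule eval_form_swap_adjacent)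
  fix xs ys and i j :: nat
  let ?L = "xs @ j # i # ys"
  have "swap_pos (length xs) (Suc (length xs)) ?L = xs @ i # j # ys"
    by (simp add: swap_pos_def list_update_append nth_append)
  moreover have "\<psi> g (swap_pos (length xs) (Suc (length xs)) ?L) = - \<psi> g ?L"
    by (rule form_on_XD(2)[OF assms]) simp_all
  ultimately show "\<psi> g (xs @ i # j # ys) = - \<psi> g ?L" by (simp only:)
qed

lemma invariant_diff_add:
  "invariant_diff a0 P f \<Longrightarrow> invariant_diff a0 P h \<Longrightarrow> invariant_diff a0 P (\<lambda>g. f g + h g)"
  by (simp add: invariant_diff_def)

lemma invariant_diff_diff:
  "invariant_diff a0 P f \<Longrightarrow> invariant_diff a0 P h \<Longrightarrow> invariant_diff a0 P (\<lambda>g. f g - h g)"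
  by (simp add: invariant_diff_def)

lemma dir_deriv_add:
  assumes "f differentiable at g" "h differentiable at g"
  shows "dir_deriv v (\<lambda>g. f g + h g) g = dir_deriv v f g + dir_deriv v h g"
proof -
  have "frechet_derivative (\<lambda>g. f g + h g) (at g) = (\<lambda>d. frechet_derivative f (at g) d + frechet_derivative h (at g) d)"
    using assms unfolding frechet_derivative_works
    by (intro frechet_derivative_at[symmetric] has_derivative_add)
  then show ?thesis by (simp add: dir_deriv_def Eder_def distrib_left sum.distrib)
qed

lemma dir_deriv_diff:
  assumes "f differentiable at g" "h differentiable at g"
  shows "dir_deriv v (\<lambda>g. f g - h g) g = dir_deriv v f g - dir_deriv v h g"
proof -
  have "frechet_derivative (\<lambda>g. f g - h g) (at g) = (\<lambda>d. frechet_derivative f (at g) d - frechet_derivative h (at g) d)"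
    using assms unfolding frechet_derivative_works
    by (intro frechet_derivative_at[symmetric] has_derivative_diff)
  then show ?thesis by (simp add: dir_deriv_def Eder_def right_diff_distrib sum_subtractf)
qed

section \<open>Evaluation, symmetry and type of the explicit forms\<close>

text \<open>Wedge products are evaluated by writing them as signed sums of tensor products of
  one-forms, with two terms in degree two and six in degree three.\<close>

lemma eval_form_decomposable:
  assumes "length \<theta>s = length vs"
  shows "eval_form (\<lambda>h L. prod_list (map2 (\<lambda>\<theta> i. \<theta> i) \<theta>s L)) g vs = prod_list (map2 apply1 \<theta>s vs)"
  using assms
proof (induction \<theta>s vs rule: list_induct2)
  case (Cons \<theta> \<theta>s v vs)
  have "eval_form (\<lambda>h L. \<theta> i * prod_list (map2 (\<lambda>\<theta> i. \<theta> i) \<theta>s L)) g vs = \<theta> i * prod_list (map2 apply1 \<theta>s vs)" for i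
    using eval_form_scale[of "\<lambda>_. \<theta> i"] Cons by simp
  then show ?case
    by (simp add: eval_form_Cons apply1_def sum_distrib_right mult_ac)
qed simp

lemma eval_phi1_form: "eval_form (phi1_form a b c) g [u] = apply1 (phic a b c 1) u"
proof -
  have "eval_form (phi1_form a b c) g [u] =
      eval_form (\<lambda>h L. prod_list (map2 (\<lambda>\<theta> i. \<theta> i) [phic a b c 1] L)) g [u]"
  proof (rule eval_form_cong)
    fix L :: "nat list" assume "length L = length [u]" "set L \<subseteq> {1..6}"
    then show "phi1_form a b c g L = prod_list (map2 (\<lambda>\<theta> i. \<theta> i) [phic a b c 1] L)"
      by (auto simp: phi1_form_def length_Suc_conv)
  qed
  then show ?thesis by (simp add: eval_form_decomposable)
qed

definition wedge2 :: "real \<Rightarrow> real \<Rightarrow> real \<Rightarrow> nat \<Rightarrow> nat \<Rightarrow> cform" where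
  "wedge2 a b c k l = (\<lambda>g L. if length L = 2 \<and> set L \<subseteq> {1..6}
     then phic a b c k (L!0) * phic a b c l (L!1) - phic a b c l (L!0) * phic a b c k (L!1) else 0)"

lemma eval_wedge2:
  "eval_form (wedge2 a b c k l) g [u, v] =
     apply1 (phic a b c k) u * apply1 (phic a b c l) v - apply1 (phic a b c l) u * apply1 (phic a b c k) v"
proof -
  let ?D = "\<lambda>ks h L. prod_list (map2 (\<lambda>\<theta> i. \<theta> i) (map (phic a b c) ks) L)"
  have "eval_form (wedge2 a b c k l) g [u, v] = eval_form (\<lambda>h L. ?D [k, l] h L + - ?D [l, k] h L) g [u, v]"
  proof (rule eval_form_cong)
    fix L :: "nat list" assume "length L = length [u, v]" "set L \<subseteq> {1..6}"
    then show "wedge2 a b c k l g L = ?D [k, l] g L + - ?D [l, k] g L"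
      by (auto simp: wedge2_def length_Suc_conv)
  qed
  then show ?thesis
    unfolding eval_form_add eval_form_minus by (simp add: eval_form_decomposable)
qed

lemma eval_phi123_form:
  "eval_form (phi123_form a b c) g [u, v, w] = det3 (\<lambda>r s. apply1 (phic a b c (Suc r)) ([u, v, w] ! s))"
proof -
  let ?D = "\<lambda>ks h L. prod_list (map2 (\<lambda>\<theta> i. \<theta> i) (map (phic a b c) ks) L)"
  have "eval_form (phi123_form a b c) g [u, v, w] = eval_form (\<lambda>h L.
      ?D [1,2,3] h L + (?D [3,1,2] h L + (?D [2,3,1] h L + (- ?D [3,2,1] h L + (- ?D [1,3,2] h L + - ?D [2,1,3] h L))))) g [u, v, w]"
  proof (rule eval_form_cong)
    fix L :: "nat list" assume "length L = length [u, v, w]" "set L \<subseteq> {1..6}"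
    then show "phi123_form a b c g L =
        ?D [1,2,3] g L + (?D [3,1,2] g L + (?D [2,3,1] g L + (- ?D [3,2,1] g L + (- ?D [1,3,2] g L + - ?D [2,1,3] g L))))"
      by (auto simp: phi123_form_def det3_def length_Suc_conv numeral_2_eq_2 numeral_3_eq_3)
  qed
  then show ?thesis
    unfolding eval_form_add eval_form_minus
    by (simp add: eval_form_decomposable det3_def numeral_2_eq_2 numeral_3_eq_3)
qed

lemma swap_pos_pair:
  assumes "i < 2" "j < 2" "i \<noteq> j"
  shows "swap_pos i j [p, q] = [q, p]"
proof -
  have "(i = 0 \<and> j = 1) \<or> (i = 1 \<and> j = 0)" using assms by auto
  then show ?thesis by (auto simp: swap_pos_def)
qed

lemma swap_pos_triple:
  assumes "i < 3" "j < 3" "i \<noteq> j"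
  shows "swap_pos i j [p, q, r] \<in> {[q, p, r], [r, q, p], [p, r, q]}"
proof -
  have "i \<in> {0,1,2}" "j \<in> {0,1,2}" using assms by auto
  then show ?thesis using assms(3) by (auto simp: swap_pos_def)
qed

lemma length_swap_pos [simp]: "length (swap_pos i j L) = length L"
  by (simp add: swap_pos_def)

lemma set_swap_pos [simp]: "i < length L \<Longrightarrow> j < length L \<Longrightarrow> set (swap_pos i j L) = set L"
  by (simp add: swap_pos_def)

lemma wedge2_swap:
  assumes "i < length L" "j < length L" "i \<noteq> j"
  shows "wedge2 a b c k l g (swap_pos i j L) = - wedge2 a b c k l g L"
proof (cases "length L = 2")
  case True
  then obtain p q where L: "L = [p, q]" by (auto simp: numeral_2_eq_2 length_Suc_conv)
  have "swap_pos i j L = [q, p]" using swap_pos_pair[of i j] assms True L by (simp add: numeral_2_eq_2)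
  then show ?thesis by (auto simp: L wedge2_def)
qed (simp add: wedge2_def)

lemma phi123_form_swap:
  assumes "i < length L" "j < length L" "i \<noteq> j"
  shows "phi123_form a b c g (swap_pos i j L) = - phi123_form a b c g L"
proof (cases "length L = 3")
  case True
  then obtain p q r where L: "L = [p, q, r]" by (auto simp: numeral_3_eq_3 length_Suc_conv)
  have "swap_pos i j L \<in> {[q, p, r], [r, q, p], [p, r, q]}" using swap_pos_triple[of i j] assms L by simp
  then show ?thesis by (auto simp: L phi123_form_def det3_def numeral_2_eq_2)
qed (simp add: phi123_form_def)

lemma is_p0_scale: "is_p0 a b c p \<phi> \<Longrightarrow> is_p0 a b c p (\<lambda>g L. s g * \<phi> g L)"
  unfolding is_p0_def eval_form_scale by simp

lemma apply1_phic_T01: "v \<in> T01 a b c \<Longrightarrow> k \<in> {1,2,3} \<Longrightarrow> apply1 (phic a b c k) v = 0"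
  unfolding T01_def by blast

lemma is_p0_phi1_form: "is_p0 a b c 1 (phi1_form a b c)"
  unfolding is_p0_def
  by (auto simp: length_Suc_conv eval_phi1_form[simplified] apply1_phic_T01[where k = 1, simplified])

lemma is_p0_wedge2:
  assumes "k \<in> {1,2,3}" "l \<in> {1,2,3}"
  shows "is_p0 a b c 2 (wedge2 a b c k l)"
proof -
  have "apply1 (phic a b c k) v = 0" "apply1 (phic a b c l) v = 0" if "v \<in> T01 a b c" for v
    using apply1_phic_T01[OF that] assms by blast+
  then show ?thesis
    unfolding is_p0_def numeral_2_eq_2 length_Suc_conv by (auto simp: eval_wedge2)
qed

lemma is_p0_phi123_form: "is_p0 a b c 3 (phi123_form a b c)"
proof -
  have z: "apply1 (phic a b c (Suc 0)) v = 0" "apply1 (phic a b c (Suc (Suc 0))) v = 0"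
    "apply1 (phic a b c (Suc (Suc (Suc 0)))) v = 0" if "v \<in> T01 a b c" for v
    using apply1_phic_T01[OF that] by (auto simp: numeral_2_eq_2 numeral_3_eq_3)
  have "det3 (\<lambda>r s. apply1 (phic a b c (Suc r)) ([u, v, w] ! s)) = 0"
    if "u \<in> T01 a b c \<or> v \<in> T01 a b c \<or> w \<in> T01 a b c" for u v w
    using that z by (auto simp: det3_def numeral_2_eq_2)
  then show ?thesis
    unfolding is_p0_def by (auto simp: numeral_3_eq_3 length_Suc_conv eval_phi123_form)
qed

lemma form_on_X_left_invariantI:
  assumes van: "\<And>g L. \<not> (length L = p \<and> set L \<subseteq> {1..6}) \<Longrightarrow> \<phi> g L = 0"
    and swap: "\<And>g L i j. i < length L \<Longrightarrow> j < length L \<Longrightarrow> i \<noteq> j \<Longrightarrow> \<phi> g (swap_pos i j L) = - \<phi> g L"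
    and const: "\<And>g L. \<phi> g L = \<phi> 0 L"
  shows "form_on_X a0 P p (\<lambda>g L. k * \<phi> g L)"
  unfolding form_on_X_def
proof (intro conjI allI ballI impI)
  fix g and L :: "nat list" assume "\<not> (length L = p \<and> set L \<subseteq> {1..6})"
  then show "k * \<phi> g L = 0" using van by simp
next
  fix g and L :: "nat list" and i j assume "i < length L \<and> j < length L \<and> i \<noteq> j"
  then show "k * \<phi> g (swap_pos i j L) = - (k * \<phi> g L)" using swap by simp
next
  fix L
  have "(\<lambda>g. k * \<phi> g L) = (\<lambda>g. k * \<phi> 0 L)" using const[of _ L] by (intro ext) (rule arg_cong)
  then show "smooth_fun (\<lambda>g. k * \<phi> g L)" by (simp only: smooth_const)
next
  fix \<gamma> g L
  show "k * \<phi> (gmul \<gamma> g) L = k * \<phi> g L"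
    using const[of "gmul \<gamma> g" L] const[of g L] by (simp only:)
qed

lemma has_cdim_line:
  assumes "\<phi> g0 L0 \<noteq> 0"
  shows "has_cdim {(\<lambda>g L. k * \<phi> g L) |k. True} 1"
  unfolding has_cdim_def
proof (intro exI[of _ "\<lambda>_. \<phi>"] conjI allI impI)
  fix c i assume "lin_comb 1 c (\<lambda>_. \<phi>) = (\<lambda>g L. 0)" and "i < (1::nat)"
  then show "c i = 0" using assms by (auto simp: lin_comb_def dest!: fun_cong[where x = g0] fun_cong[where x = L0])
next
  show "{(\<lambda>g L. k * \<phi> g L) |k. True} = {lin_comb 1 c (\<lambda>_. \<phi>) |c. True}"
    by (auto simp: lin_comb_def)
qed

text \<open>The forms phi^1 ^ (phi^2 - phi^3) and phi^1 ^ (phi^2 + phi^3) diagonalise the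
  zeroth-order term of the conj V_1 equation, with opposite eigenvalues; hence the opposite
  frequencies.\<close>

definition wave_form :: "real \<Rightarrow> real \<Rightarrow> real \<Rightarrow> complex \<Rightarrow> complex \<Rightarrow> cform" where
  "wave_form a b c A B = (\<lambda>g L.
     (A * wave (c / 2) g) * (wedge2 a b c 1 2 g L - wedge2 a b c 1 3 g L) +
     (B * wave (- (c / 2)) g) * (wedge2 a b c 1 2 g L + wedge2 a b c 1 3 g L))"

lemma wedge2_vanish: "\<not> (length L = 2 \<and> set L \<subseteq> {1..6}) \<Longrightarrow> wedge2 a b c k l g L = 0"
  unfolding wedge2_def by (rule if_not_P)

lemma wave_form_vanish:
  assumes "\<not> (length L = 2 \<and> set L \<subseteq> {1..6})"
  shows "wave_form a b c A B g L = 0"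
  unfolding wave_form_def wedge2_vanish[OF assms] by simp

lemma eval_wave_form:
  "eval_form (wave_form a b c A B) g vs =
     (A * (eval_form (wedge2 a b c 1 2) g vs - eval_form (wedge2 a b c 1 3) g vs)) * wave (c / 2) g +
     (B * (eval_form (wedge2 a b c 1 2) g vs + eval_form (wedge2 a b c 1 3) g vs)) * wave (- (c / 2)) g"
proof -
  have "eval_form (\<lambda>g L. wedge2 a b c 1 2 g L - wedge2 a b c 1 3 g L) g vs =
      eval_form (wedge2 a b c 1 2) g vs - eval_form (wedge2 a b c 1 3) g vs"
    using eval_form_add[of "wedge2 a b c 1 2" "\<lambda>g L. - wedge2 a b c 1 3 g L" g vs]
    by (simp add: eval_form_minus)
  then show ?thesis
    unfolding wave_form_def eval_form_add eval_form_scale by (simp add: mult_ac)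
qed

lemma is_p0_wave_form: "is_p0 a b c 2 (wave_form a b c A B)"
  using is_p0_wedge2[of 1 2 a b c] is_p0_wedge2[of 1 3 a b c]
  unfolding is_p0_def eval_wave_form by simp

lemma wedge2_const: "wedge2 a b c k l g L = wedge2 a b c k l h L"
  by (simp add: wedge2_def)

text \<open>The disjunction treats all values of c together: either the form is zero, or both waves
  have period one in x.\<close>

lemma form_on_X_wave_form:
  assumes "A = 0 \<and> B = 0 \<or> exp (\<i> * of_real (c / 2)) = 1"
  shows "form_on_X a0 P 2 (wave_form a b c A B)"
  unfolding form_on_X_def
proof (intro conjI allI ballI impI)
  fix g and L :: "nat list" assume "\<not> (length L = 2 \<and> set L \<subseteq> {1..6})"
  then show "wave_form a b c A B g L = 0" by (rule wave_form_vanish)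
next
  fix g and L :: "nat list" and i j assume "i < length L \<and> j < length L \<and> i \<noteq> j"
  then show "wave_form a b c A B g (swap_pos i j L) = - wave_form a b c A B g L"
    by (simp add: wave_form_def wedge2_swap algebra_simps)
next
  fix L
  have "wave_form a b c A B = (\<lambda>g L. (A * (wedge2 a b c 1 2 0 L - wedge2 a b c 1 3 0 L)) * wave (c / 2) g +
     (B * (wedge2 a b c 1 2 0 L + wedge2 a b c 1 3 0 L)) * wave (- (c / 2)) g)"
    unfolding wave_form_def wedge2_def by (simp add: mult_ac)
  then show "smooth_fun (\<lambda>g. wave_form a b c A B g L)"
    by (simp only: smooth_wave_sum)
next
  fix \<gamma> g L assume \<gamma>: "\<gamma> \<in> lattice a0 P"
  show "wave_form a b c A B (gmul \<gamma> g) L = wave_form a b c A B g L"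
    using assms
  proof
    assume e: "exp (\<i> * of_real (c / 2)) = 1"
    then have "exp (\<i> * of_real (- (c / 2))) = 1"
      using exp_minus[of "\<i> * complex_of_real (c / 2)"] by simp
    then show ?thesis
      unfolding wave_form_def
      by (simp only: wave_lattice_invariant[OF e \<gamma>] wave_lattice_invariant[OF _ \<gamma>]
          wedge2_const[of a b c _ _ "gmul \<gamma> g" L g])
  qed (simp add: wave_form_def)
qed

section \<open>Closed forms in each degree\<close>

context
  fixes a b c a0 :: real and P :: "real^2^2"
  assumes a_nz: "a \<noteq> 0" and c_nz: "c \<noteq> 0" and a0_pos: "a0 > 0" and P_inv: "invertible P"
begin

lemma Hp0_iff:
  "\<psi> \<in> Hp0 a0 P a b c p \<longleftrightarrow> form_on_X a0 P p \<psi> \<and> is_p0 a b c p \<psi> \<and>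
    (\<forall>g K k. length K = p \<and> set K \<subseteq> {1,2,3} \<and> k \<in> {1,2,3} \<longrightarrow>
      dir_deriv (frame01 a b c k) (\<lambda>h. eval_form \<psi> h (map (frame10 a b c) K)) g +
      (\<Sum>j<p. (-1)^j * (\<Sum>m\<in>{1,2,3}. conn a c m (K!j) k *
          eval_form \<psi> g (map (frame10 a b c) (m # rem j K)))) = 0)"
proof (cases "form_on_X a0 P p \<psi> \<and> is_p0 a b c p \<psi>")
  case True
  then have "(\<lambda>h. \<psi> h L) differentiable at g" for L g using form_on_X_differentiable by blast
  from dbar_closed_iff[where \<psi> = \<psi> and b = b and p = p, OF a_nz c_nz this] True show ?thesis
    unfolding Hp0_def by blast
qed (auto simp: Hp0_def)

lemma constant_on_fibresI:
  assumes "invariant_diff a0 P f"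
    and "\<And>g. dir_deriv (frame01 a b c 2) f g = 0" "\<And>g. dir_deriv (frame01 a b c 3) f g = 0"
  shows "constant_on_fibres f"
  unfolding constant_on_fibres_def
  using dbar_constant_along_fibre[OF c_nz P_inv assms(1), of a b _ _ 0 0] assms(2,3) by blast

text \<open>The equations for conj V_2 and conj V_3 make \<open>f\<close> constant on fibres; the
  twisted equation with \<kappa> = 0 then makes it constant on the base.\<close>

lemma dbar_zero_constant:
  assumes f: "invariant_diff a0 P f"
    and d: "\<And>g k. k \<in> {1,2,3} \<Longrightarrow> dir_deriv (frame01 a b c k) f g = 0"
  shows "f g = f 0"
proof -
  obtain t x y1 y2 z1 z2 where g: "g = (t,x,y1,y2,z1,z2)" by (cases g)
  have "constant_on_fibres f" by (rule constant_on_fibresI[OF f]) (simp_all add: d)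
  from twisted_dbar_on_base(1)[OF a_nz a0_pos f this, where \<kappa> = 0 and b = b and c = c] d show ?thesis
    unfolding g by simp
qed

section \<open>Degree one\<close>

lemma eval_phi1_frame10:
  assumes "j \<in> {1,2,3}"
  shows "eval_form (phi1_form a b c) g [frame10 a b c j] = (if j = 1 then 1 else 0)"
  using apply1_phic_frame10[OF a_nz c_nz, of 1 j] assms unfolding eval_phi1_form by auto

text \<open>No bracket [V_j, conj V_k] has a component along V_1, the only frame vector V_m on which
  phi^1 is nonzero. So all zeroth-order terms vanish.\<close>

lemma phi1_form_in_Hp0: "(\<lambda>g L. k * phi1_form a b c g L) \<in> Hp0 a0 P a b c 1"
  unfolding Hp0_iff
proof (intro conjI allI impI)
  show "form_on_X a0 P 1 (\<lambda>g L. k * phi1_form a b c g L)"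
  proof (rule form_on_X_left_invariantI)
    show "phi1_form a b c g (swap_pos i j L) = - phi1_form a b c g L"
      if "i < length L" "j < length L" "i \<noteq> j" for g L i j
      using that by (cases "length L = 1") (auto simp: phi1_form_def)
    show "phi1_form a b c g L = 0" if "\<not> (length L = 1 \<and> set L \<subseteq> {1..6})" for g L
      using that by (auto simp: phi1_form_def length_Suc_conv)
    show "phi1_form a b c g L = phi1_form a b c 0 L" for g L
      by (simp add: phi1_form_def)
  qed
  show "is_p0 a b c 1 (\<lambda>g L. k * phi1_form a b c g L)"
    by (rule is_p0_scale[OF is_p0_phi1_form, of _ _ _ "\<lambda>_. k"])
next
  fix g and K :: "nat list" and l assume "length K = 1 \<and> set K \<subseteq> {1,2,3} \<and> l \<in> {1,2,3::nat}"
  then obtain j where K: "K = [j]" and j: "j \<in> {1,2,3}" by (auto simp: length_Suc_conv)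
  have ev: "eval_form (\<lambda>g L. k * phi1_form a b c g L) g [frame10 a b c i] = k * (if i = 1 then 1 else 0)"
    if "i \<in> {1,2,3}" for i g
    unfolding eval_form_scale[of "\<lambda>_. k"] eval_phi1_frame10[OF that] ..
  have c0: "conn a c 1 j l = 0" by (simp add: conn_def)
  show "dir_deriv (frame01 a b c l) (\<lambda>h. eval_form (\<lambda>g L. k * phi1_form a b c g L) h (map (frame10 a b c) K)) g +
      (\<Sum>j<1. (-1)^j * (\<Sum>m\<in>{1,2,3}. conn a c m (K!j) l *
          eval_form (\<lambda>g L. k * phi1_form a b c g L) g (map (frame10 a b c) (m # rem j K)))) = 0"
    using j c0 by (simp add: K ev[simplified])
qed

text \<open>Along the fibre the equations of f_2 and f_3 have no zeroth-order terms, so both depend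
  on (t,x) only. Then conj V_2 f_1 and conj V_3 f_1 are constant on each fibre, hence zero, and this
  linear system forces f_2 = f_3 = 0. Finally f_1 is constant.\<close>

lemma Hp0_1_subset:
  assumes \<psi>: "\<psi> \<in> Hp0 a0 P a b c 1"
  shows "\<exists>k. \<psi> = (\<lambda>g L. k * phi1_form a b c g L)"
proof -
  have form: "form_on_X a0 P 1 \<psi>" and p0: "is_p0 a b c 1 \<psi>" using \<psi> unfolding Hp0_iff by blast+
  define f where "f j g = eval_form \<psi> g [frame10 a b c j]" for j g
  have inv: "invariant_diff a0 P (f j)" for j
    unfolding f_def by (rule form_on_X_eval_invariant[OF form])
  have eq: "dir_deriv (frame01 a b c k) (f j) g +
      (conn a c 1 j k * f 1 g + (conn a c 2 j k * f 2 g + conn a c 3 j k * f 3 g)) = 0"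
    if "j \<in> {1,2,3}" "k \<in> {1,2,3}" for j k g
  proof -
    have "length [j] = 1 \<and> set [j] \<subseteq> {1,2,3} \<and> k \<in> {1,2,3}" using that by simp
    then have "dir_deriv (frame01 a b c k) (\<lambda>h. eval_form \<psi> h (map (frame10 a b c) [j])) g +
      (\<Sum>i<1. (-1)^i * (\<Sum>m\<in>{1,2,3}. conn a c m ([j]!i) k *
          eval_form \<psi> g (map (frame10 a b c) (m # rem i [j])))) = 0"
      using \<psi> unfolding Hp0_iff by blast
    then show ?thesis unfolding sum_1_3 f_def by simp
  qed
  have f2: "constant_on_fibres (f 2)" and f3: "constant_on_fibres (f 3)"
    using eq[of 2 2] eq[of 2 3] eq[of 3 2] eq[of 3 3]
    by (auto intro!: constant_on_fibresI inv simp: conn_def)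
  have fib: "f 2 (t,x,0,0,0,0) / of_real (2 * a) + of_real (c / 4) * f 3 (t,x,0,0,0,0) = 0 \<and>
      of_real (c / 4) * f 2 (t,x,0,0,0,0) - f 3 (t,x,0,0,0,0) / of_real (2 * a) = 0 \<and>
      f 1 (t,x,y1,y2,z1,z2) = f 1 (t,x,0,0,0,0)" for t x y1 y2 z1 z2
  proof -
    \<comment> \<open>These are the values that \<open>conn\<close> prescribes for conj V_2 f_1 and
      conj V_3 f_1.\<close>
    let ?k2 = "- (f 2 (t,x,0,0,0,0) / of_real (2 * a) + of_real (c / 4) * f 3 (t,x,0,0,0,0))"
    let ?k3 = "- (of_real (c / 4) * f 2 (t,x,0,0,0,0) - f 3 (t,x,0,0,0,0) / of_real (2 * a))"
    have F: "f 2 (t,x,y1,y2,z1,z2) = f 2 (t,x,0,0,0,0)" "f 3 (t,x,y1,y2,z1,z2) = f 3 (t,x,0,0,0,0)"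
      for y1 y2 z1 z2 using f2 f3 unfolding constant_on_fibres_def by blast+
    have "?k2 = 0 \<and> ?k3 = 0 \<and> f 1 (t,x,y1,y2,z1,z2) = f 1 (t,x,0,0,0,0)"
    proof (rule dbar_constant_along_fibre[OF c_nz P_inv inv])
      fix y1 y2 z1 z2
      show "dir_deriv (frame01 a b c 2) (f 1) (t,x,y1,y2,z1,z2) = ?k2"
        using eq[of 1 2 "(t,x,y1,y2,z1,z2)"] F[of y1 y2 z1 z2]
        by (simp add: conn_def add_eq_0_iff2)
      show "dir_deriv (frame01 a b c 3) (f 1) (t,x,y1,y2,z1,z2) = ?k3"
        using eq[of 1 3 "(t,x,y1,y2,z1,z2)"] F[of y1 y2 z1 z2]
        by (simp add: conn_def add_eq_0_iff2)
    qed
    then show ?thesis by (simp only: neg_equal_0_iff_equal)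
  qed
  have f23: "f 2 g = 0 \<and> f 3 g = 0" for g
  proof -
    obtain t x y1 y2 z1 z2 where g: "g = (t,x,y1,y2,z1,z2)" by (cases g)
    let ?u = "f 2 (t,x,0,0,0,0)" and ?v = "f 3 (t,x,0,0,0,0)"
    let ?p = "complex_of_real (1 / (2 * a))" and ?q = "complex_of_real (c / 4)"
    have 1: "?p * ?u + ?q * ?v = 0" "?q * ?u - ?p * ?v = 0" using fib[of t x] by simp_all
    have 2: "?p * ?p + ?q * ?q \<noteq> 0"
    proof -
      have "(1 / (2 * a)) * (1 / (2 * a)) + (c / 4) * (c / 4) > 0"
        using c_nz by (intro add_nonneg_pos zero_le_square) (auto simp: zero_less_mult_iff)
      then show ?thesis unfolding of_real_mult[symmetric] of_real_add[symmetric] of_real_eq_0_iff by simp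
    qed
    \<comment> \<open>The matrix with rows (p, q) and (q, -p) squares to p^2 + q^2 times the
      identity, so applying it once more isolates each unknown.\<close>
    have "(?p * ?p + ?q * ?q) * ?u = ?p * (?p * ?u + ?q * ?v) + ?q * (?q * ?u - ?p * ?v)"
      "(?p * ?p + ?q * ?q) * ?v = ?q * (?p * ?u + ?q * ?v) - ?p * (?q * ?u - ?p * ?v)"
      by (simp_all only: algebra_simps)
    then have "?u = 0" "?v = 0" using 2 unfolding 1 by simp_all
    then show ?thesis using f2 f3 unfolding g constant_on_fibres_def by metis
  qed
  have "f 1 g = f 1 0" for g
  proof (rule dbar_zero_constant[OF inv])
    show "dir_deriv (frame01 a b c k) (f 1) g = 0" if "k \<in> {1,2,3}" for g k
      using eq[of 1 k g] that f23 by (auto simp: conn_def)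
  qed
  then have f1: "f 1 = (\<lambda>g. f 1 0)" by blast
  have "\<psi> = (\<lambda>g L. f 1 0 * phi1_form a b c g L)"
  proof (rule p0_form_eqI[OF a_nz c_nz p0 is_p0_scale[OF is_p0_phi1_form, of _ _ _ "\<lambda>_. f 1 0"]])
    show "\<And>g L. \<not> (length L = 1 \<and> set L \<subseteq> {1..6}) \<Longrightarrow> \<psi> g L = 0"
      by (rule form_on_XD(1)[OF form])
    show "\<And>g L. \<not> (length L = 1 \<and> set L \<subseteq> {1..6}) \<Longrightarrow> f 1 0 * phi1_form a b c g L = 0"
      by (auto simp: phi1_form_def length_Suc_conv)
  next
    fix g and K :: "nat list" assume "length K = 1" "set K \<subseteq> {1,2,3}"
    then obtain j where K: "K = [j]" and j: "j \<in> {1,2,3}" by (auto simp: length_Suc_conv)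
    have "f j g = f 1 0 * (if j = 1 then 1 else 0)" 
      using j f23[of g] fun_cong[OF f1, of g] by auto
    then show "eval_form \<psi> g (map (frame10 a b c) K) =
        eval_form (\<lambda>g L. f 1 0 * phi1_form a b c g L) g (map (frame10 a b c) K)"
      unfolding K list.map eval_form_scale[of "\<lambda>_. f 1 0"] eval_phi1_frame10[OF j] by (simp add: f_def)
  qed
  then show ?thesis by blast
qed

section \<open>Degree two\<close>

lemma eval_wedge2_frame10:
  assumes "i \<in> {1,2,3}" "j \<in> {1,2,3}" "k \<in> {1,2,3}" "l \<in> {1,2,3}"
  shows "eval_form (wedge2 a b c k l) g [frame10 a b c i, frame10 a b c j] =
    (if k = i \<and> l = j then 1 else 0) - (if l = i \<and> k = j then 1 else 0)"
proof -
  have "(if p then 1 else 0) * (if q then 1 else 0) = (if p \<and> q then 1 else (0::complex))" for p q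
    by simp
  then show ?thesis
    by (simp only: eval_wedge2 apply1_phic_frame10[OF a_nz c_nz] assms)
qed

text \<open>For distinct arguments, the bracket terms in the fibre directions and in the equations
  of the (2,3) component contain only that component or repeated arguments, all zero. In direction
  conj V_1 the derivative of the waves balances the entries -c/4 of \<open>conn\<close>.\<close>

lemma wave_form_in_Hp0:
  assumes "A = 0 \<and> B = 0 \<or> exp (\<i> * of_real (c / 2)) = 1"
  shows "wave_form a b c A B \<in> Hp0 a0 P a b c 2"
  unfolding Hp0_iff
proof (intro conjI allI impI)
  show "form_on_X a0 P 2 (wave_form a b c A B)" by (rule form_on_X_wave_form[OF assms])
  show "is_p0 a b c 2 (wave_form a b c A B)" by (rule is_p0_wave_form)
next
  fix g and K :: "nat list" and k assume K: "length K = 2 \<and> set K \<subseteq> {1,2,3} \<and> k \<in> {1,2,3::nat}"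
  then obtain i j where Kij: "K = [i, j]" by (auto simp: numeral_2_eq_2 length_Suc_conv)
  with K have ij: "i \<in> {1,2,3}" "j \<in> {1,2,3}" and k: "k \<in> {1,2,3}" by simp_all
  \<comment> \<open>\<open>C x y l\<close> is the value of phi^1 ^ phi^l on (V_x, V_y).\<close>
  define C where "C x y l = (if x = 1 \<and> y = l then 1 else 0) - (if x = l \<and> y = 1 then 1 else (0::complex))"
    for x y l :: nat
  have ev: "eval_form (wave_form a b c A B) h [frame10 a b c x, frame10 a b c y] =
      (A * (C x y 2 - C x y 3)) * wave (c / 2) h + (B * (C x y 2 + C x y 3)) * wave (- (c / 2)) h"
    if "x \<in> {1,2,3}" "y \<in> {1,2,3}" for x y h
    unfolding eval_wave_form C_def using that by (auto simp: eval_wedge2_frame10)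
  have rems: "rem 0 [i, j] = [j]" "rem 1 [i, j] = [i]" by (simp_all add: rem_def)
  have sum2: "(\<Sum>n<2::nat. F n) = F 0 + F 1" for F :: "nat \<Rightarrow> complex"
    by (simp add: numeral_2_eq_2)
  have mem: "1 \<in> {1,2,3::nat}" "2 \<in> {1,2,3::nat}" "3 \<in> {1,2,3::nat}" by simp_all
  show "dir_deriv (frame01 a b c k) (\<lambda>h. eval_form (wave_form a b c A B) h (map (frame10 a b c) K)) g +
      (\<Sum>n<2. (-1)^n * (\<Sum>m\<in>{1,2,3}. conn a c m (K!n) k *
          eval_form (wave_form a b c A B) g (map (frame10 a b c) (m # rem n K)))) = 0"
    unfolding Kij sum2 rems list.map sum_1_3
    unfolding ev[OF ij] ev[OF mem(1) ij(1)] ev[OF mem(2) ij(1)] ev[OF mem(3) ij(1)]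
      ev[OF mem(1) ij(2)] ev[OF mem(2) ij(2)] ev[OF mem(3) ij(2)] dir_deriv_wave_sum
    using ij k
    by (elim insertE emptyE; simp add: C_def conn_def field_simps)
qed

text \<open>The equations of f_23 contain only repeated arguments besides the derivative, so f_23 is
  constant. It is then the constant source of f_12 along the fibre and must vanish. So f_12 and f_13
  live on the base, where their sum and difference decouple.\<close>

lemma Hp0_2_subset:
  assumes \<psi>: "\<psi> \<in> Hp0 a0 P a b c 2"
  shows "\<exists>A B. \<psi> = wave_form a b c A B \<and> (A = 0 \<and> B = 0 \<or> exp (\<i> * of_real (c / 2)) = 1)"
proof -
  have form: "form_on_X a0 P 2 \<psi>" and p0: "is_p0 a b c 2 \<psi>" using \<psi> unfolding Hp0_iff by blast+
  define f where "f i j g = eval_form \<psi> g [frame10 a b c i, frame10 a b c j]" for i j g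
  have inv: "invariant_diff a0 P (f i j)" for i j
    unfolding f_def by (rule form_on_X_eval_invariant[OF form])
  then have df: "f i j differentiable at g" for i j g unfolding invariant_diff_def by blast
  have swap: "f j i g = - f i j g" for i j g
    using form_on_X_swap[OF form, of g "[]" "frame10 a b c j" "frame10 a b c i" "[]"] by (simp add: f_def)
  have diag: "f i i g = 0" for i g using swap[of i i g] by simp
  have eq: "dir_deriv (frame01 a b c k) (f i j) g +
      ((conn a c 1 i k * f 1 j g + (conn a c 2 i k * f 2 j g + conn a c 3 i k * f 3 j g)) -
       (conn a c 1 j k * f 1 i g + (conn a c 2 j k * f 2 i g + conn a c 3 j k * f 3 i g))) = 0"
    if "i \<in> {1,2,3}" "j \<in> {1,2,3}" "k \<in> {1,2,3}" for i j k g
  proof -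
    have "length [i, j] = 2 \<and> set [i, j] \<subseteq> {1,2,3} \<and> k \<in> {1,2,3}" using that by simp
    then have "dir_deriv (frame01 a b c k) (\<lambda>h. eval_form \<psi> h (map (frame10 a b c) [i, j])) g +
      (\<Sum>n<2. (-1)^n * (\<Sum>m\<in>{1,2,3}. conn a c m ([i, j]!n) k *
          eval_form \<psi> g (map (frame10 a b c) (m # rem n [i, j])))) = 0"
      using \<psi> unfolding Hp0_iff by blast
    moreover have "(\<Sum>n<2::nat. F n) = F 0 + F 1" for F :: "nat \<Rightarrow> complex"
      by (simp add: numeral_2_eq_2)
    ultimately show ?thesis unfolding sum_1_3 f_def by (simp add: algebra_simps)
  qed
  have f23_const: "f 2 3 g = f 2 3 0" for g
  proof (rule dbar_zero_constant[OF inv])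
    show "dir_deriv (frame01 a b c k) (f 2 3) g = 0" if "k \<in> {1,2,3}" for g k
      using eq[of 2 3 k g] that by (auto simp: conn_def diag)
  qed
  \<comment> \<open>The Liouville argument yields the vanishing of both sources, and with it f_23 =
    0, together with the constancy of f_12 on fibres.\<close>
  have f12: "of_real (c / 4) * f 2 3 0 = 0 \<and> - (f 2 3 0 / of_real (2 * a)) = 0 \<and>
      f 1 2 (t,x,y1,y2,z1,z2) = f 1 2 (t,x,0,0,0,0)" for t x y1 y2 z1 z2
  proof (rule dbar_constant_along_fibre[OF c_nz P_inv inv])
    fix y1 y2 z1 z2
    let ?g = "(t,x,y1,y2,z1,z2) :: pt"
    have 32: "f 3 2 ?g = - f 2 3 0" using swap[of 2 3 ?g] f23_const[of ?g] by simp
    show "dir_deriv (frame01 a b c 2) (f 1 2) ?g = of_real (c / 4) * f 2 3 0"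
      using eq[of 1 2 2 ?g] 32 by (simp add: conn_def diag)
    show "dir_deriv (frame01 a b c 3) (f 1 2) ?g = - (f 2 3 0 / of_real (2 * a))"
      using eq[of 1 2 3 ?g] 32 by (simp add: conn_def diag add_eq_0_iff2)
  qed
  then have "f 2 3 0 = 0" using c_nz by simp
  then have f23: "f 2 3 g = 0" for g using f23_const by simp
  have fib12: "constant_on_fibres (f 1 2)" using f12 unfolding constant_on_fibres_def by blast
  have fib13: "constant_on_fibres (f 1 3)"
  proof (rule constant_on_fibresI[OF inv])
    fix g
    show "dir_deriv (frame01 a b c 2) (f 1 3) g = 0" "dir_deriv (frame01 a b c 3) (f 1 3) g = 0"
      using eq[of 1 3 2 g] eq[of 1 3 3 g] f23[of g] by (simp_all add: conn_def diag)
  qed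
  \<comment> \<open>Up to the factor c/4, conj V_1 interchanges f_12 and f_13. Hence the sum and the
    difference satisfy twisted equations with \<kappa> = c/2 and \<kappa> = -c/2.\<close>
  have d1: "dir_deriv (frame01 a b c 1) (f 1 2) g = of_real (c / 4) * f 1 3 g"
    "dir_deriv (frame01 a b c 1) (f 1 3) g = of_real (c / 4) * f 1 2 g" for g
    using eq[of 1 2 1 g] eq[of 1 3 1 g] swap[of 3 1 g] swap[of 2 1 g] by (simp_all add: conn_def)
  define u where "u g = f 1 2 g + f 1 3 g" for g
  define v where "v g = f 1 2 g - f 1 3 g" for g
  have invu: "invariant_diff a0 P u" and invv: "invariant_diff a0 P v"
    unfolding u_def v_def by (intro invariant_diff_add invariant_diff_diff inv)+
  have fibu: "constant_on_fibres u" and fibv: "constant_on_fibres v"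
    using fib12 fib13 unfolding constant_on_fibres_def u_def v_def by metis+
  have du: "dir_deriv (frame01 a b c 1) u g = of_real ((c / 2) / 2) * u g" for g
    unfolding u_def dir_deriv_add[OF df df] d1 by (simp add: algebra_simps)
  have dv: "dir_deriv (frame01 a b c 1) v g = of_real (- (c / 2) / 2) * v g" for g
    unfolding v_def dir_deriv_diff[OF df df] d1 by (simp add: algebra_simps)
  have u: "u g = u 0 * wave (- (c / 2)) g" for g
    using twisted_dbar_on_base(1)[OF a_nz a0_pos invu fibu du] by (cases g) (simp add: wave_def)
  have v: "v g = v 0 * wave (c / 2) g" for g
    using twisted_dbar_on_base(1)[OF a_nz a0_pos invv fibv dv] by (cases g) (simp add: wave_def)
  have per: "u 0 * exp (\<i> * of_real (c / 2)) = u 0" "v 0 * exp (\<i> * of_real (- (c / 2))) = v 0"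
    using twisted_dbar_on_base(2)[OF a_nz a0_pos invu fibu du]
      twisted_dbar_on_base(2)[OF a_nz a0_pos invv fibv dv] by simp_all
  \<comment> \<open>Each period relation kills its amplitude unless its exponential is 1, and the
    two exponentials are inverse to each other.\<close>
  have "v 0 / 2 = 0 \<and> u 0 / 2 = 0 \<or> exp (\<i> * of_real (c / 2)) = 1"
    using per exp_minus[of "\<i> * complex_of_real (c / 2)"] by (auto simp: inverse_eq_1_iff)
  moreover have "\<psi> = wave_form a b c (v 0 / 2) (u 0 / 2)"
  proof (rule p0_form_eqI[OF a_nz c_nz p0 is_p0_wave_form])
    show "\<And>g L. \<not> (length L = 2 \<and> set L \<subseteq> {1..6}) \<Longrightarrow> \<psi> g L = 0"
      by (rule form_on_XD(1)[OF form])
    show "\<And>g L. \<not> (length L = 2 \<and> set L \<subseteq> {1..6}) \<Longrightarrow> wave_form a b c (v 0 / 2) (u 0 / 2) g L = 0"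
      by (rule wave_form_vanish)
  next
    fix g and K :: "nat list" assume "length K = 2" "set K \<subseteq> {1,2,3}"
    then obtain i j where K: "K = [i, j]" and ij: "i \<in> {1,2,3}" "j \<in> {1,2,3}"
      by (auto simp: numeral_2_eq_2 length_Suc_conv)
    have s: "f 1 2 g = (v 0 / 2) * wave (c / 2) g + (u 0 / 2) * wave (- (c / 2)) g"
      "f 1 3 g = - (v 0 / 2) * wave (c / 2) g + (u 0 / 2) * wave (- (c / 2)) g"
    proof -
      have "f 1 2 g = (u g + v g) / 2" "f 1 3 g = (u g - v g) / 2" by (simp_all add: u_def v_def)
      then show "f 1 2 g = (v 0 / 2) * wave (c / 2) g + (u 0 / 2) * wave (- (c / 2)) g"
        "f 1 3 g = - (v 0 / 2) * wave (c / 2) g + (u 0 / 2) * wave (- (c / 2)) g"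
        unfolding u[of g] v[of g] by (simp_all add: field_simps)
    qed
    have "f i j g = (v 0 / 2 * (eval_form (wedge2 a b c 1 2) g [frame10 a b c i, frame10 a b c j] -
          eval_form (wedge2 a b c 1 3) g [frame10 a b c i, frame10 a b c j])) * wave (c / 2) g +
        (u 0 / 2 * (eval_form (wedge2 a b c 1 2) g [frame10 a b c i, frame10 a b c j] +
          eval_form (wedge2 a b c 1 3) g [frame10 a b c i, frame10 a b c j])) * wave (- (c / 2)) g"
      using ij s swap[of 2 1 g] swap[of 3 1 g] swap[of 3 2 g] f23[of g] diag[of _ g]
      by (elim insertE emptyE; simp add: eval_wedge2_frame10[simplified])
    then show "eval_form \<psi> g (map (frame10 a b c) K) =
        eval_form (wave_form a b c (v 0 / 2) (u 0 / 2)) g (map (frame10 a b c) K)"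
      unfolding K eval_wave_form by (simp add: f_def)
  qed
  ultimately show ?thesis by blast
qed

section \<open>Degree three\<close>

lemma eval_phi123_frame10:
  assumes "i \<in> {1,2,3}" "j \<in> {1,2,3}" "k \<in> {1,2,3}"
  shows "eval_form (phi123_form a b c) g [frame10 a b c i, frame10 a b c j, frame10 a b c k] =
    det3 (\<lambda>r s. if Suc r = [i, j, k] ! s then 1 else 0)"
proof -
  let ?V = "frame10 a b c"
  have "apply1 (phic a b c (Suc r)) ([?V i, ?V j, ?V k] ! s) = (if Suc r = [i, j, k] ! s then 1 else 0)"
    if "r \<in> {0,1,2}" "s \<in> {0,1,2}" for r s
  proof -
    have "Suc r \<in> {1,2,3}" "[i, j, k] ! s \<in> {1,2,3}" "[?V i, ?V j, ?V k] ! s = ?V ([i, j, k] ! s)"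
      using that assms by auto
    then show ?thesis using apply1_phic_frame10[OF a_nz c_nz] by (simp only:)
  qed
  then show ?thesis
    unfolding eval_phi123_form det3_def by (simp only: insert_iff simp_thms)
qed

text \<open>\<open>conn\<close> has no nonzero entry with m = j, so replacing one of three distinct
  frame vectors by the (1,0) part of its bracket repeats another one, and alternation makes the term
  vanish.\<close>

lemma phi123_form_in_Hp0: "(\<lambda>g L. q * phi123_form a b c g L) \<in> Hp0 a0 P a b c 3"
  unfolding Hp0_iff
proof (intro conjI allI impI)
  show "form_on_X a0 P 3 (\<lambda>g L. q * phi123_form a b c g L)"
  proof (rule form_on_X_left_invariantI[OF _ phi123_form_swap])
    show "phi123_form a b c g L = 0" if "\<not> (length L = 3 \<and> set L \<subseteq> {1..6})" for g L
      using that unfolding phi123_form_def by (rule if_not_P)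
    show "phi123_form a b c g L = phi123_form a b c 0 L" for g L
      by (simp add: phi123_form_def)
  qed
  show "is_p0 a b c 3 (\<lambda>g L. q * phi123_form a b c g L)"
    by (rule is_p0_scale[OF is_p0_phi123_form, of _ _ _ "\<lambda>_. q"])
next
  fix g and K :: "nat list" and l assume K: "length K = 3 \<and> set K \<subseteq> {1,2,3} \<and> l \<in> {1,2,3::nat}"
  then obtain i j k where Kijk: "K = [i, j, k]" by (auto simp: numeral_3_eq_3 length_Suc_conv)
  with K have ijk: "i \<in> {1,2,3}" "j \<in> {1,2,3}" "k \<in> {1,2,3}" and l: "l \<in> {1,2,3}" by simp_all
  define D where "D x y z = det3 (\<lambda>r s. if Suc r = [x, y, z] ! s then 1 else 0)" for x y z :: nat
  have ev: "eval_form (\<lambda>g L. q * phi123_form a b c g L) h [frame10 a b c x, frame10 a b c y, frame10 a b c z] =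
      q * D x y z" if "x \<in> {1,2,3}" "y \<in> {1,2,3}" "z \<in> {1,2,3}" for x y z h
    unfolding eval_form_scale[of "\<lambda>_. q"] eval_phi123_frame10[OF that] D_def ..
  have rems: "rem 0 [i, j, k] = [j, k]" "rem 1 [i, j, k] = [i, k]" "rem 2 [i, j, k] = [i, j]"
    by (simp_all add: rem_def)
  have sum3: "(\<Sum>n<3::nat. F n) = F 0 + F 1 + F 2" for F :: "nat \<Rightarrow> complex"
    by (simp add: numeral_3_eq_3 numeral_2_eq_2)
  have mem: "1 \<in> {1,2,3::nat}" "2 \<in> {1,2,3::nat}" "3 \<in> {1,2,3::nat}" by simp_all
  show "dir_deriv (frame01 a b c l) (\<lambda>h. eval_form (\<lambda>g L. q * phi123_form a b c g L) h (map (frame10 a b c) K)) g +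
      (\<Sum>n<3. (-1)^n * (\<Sum>m\<in>{1,2,3}. conn a c m (K!n) l *
          eval_form (\<lambda>g L. q * phi123_form a b c g L) g (map (frame10 a b c) (m # rem n K)))) = 0"
    unfolding Kijk sum3 rems list.map sum_1_3
    unfolding ev[OF ijk] ev[OF mem(1) ijk(1,2)] ev[OF mem(2) ijk(1,2)] ev[OF mem(3) ijk(1,2)]
      ev[OF mem(1) ijk(1,3)] ev[OF mem(2) ijk(1,3)] ev[OF mem(3) ijk(1,3)]
      ev[OF mem(1) ijk(2,3)] ev[OF mem(2) ijk(2,3)] ev[OF mem(3) ijk(2,3)]
    using ijk l
    by (elim insertE emptyE; simp add: D_def det3_def conn_def)
qed

text \<open>By the same repetition of arguments, f_123 satisfies the untwisted equations and is
  constant; alternation gives the remaining values.\<close>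

lemma Hp0_3_subset:
  assumes \<psi>: "\<psi> \<in> Hp0 a0 P a b c 3"
  shows "\<exists>q. \<psi> = (\<lambda>g L. q * phi123_form a b c g L)"
proof -
  have form: "form_on_X a0 P 3 \<psi>" and p0: "is_p0 a b c 3 \<psi>" using \<psi> unfolding Hp0_iff by blast+
  define f where "f i j k g = eval_form \<psi> g [frame10 a b c i, frame10 a b c j, frame10 a b c k]" for i j k g
  have inv: "invariant_diff a0 P (f i j k)" for i j k
    unfolding f_def by (rule form_on_X_eval_invariant[OF form])
  have swap12: "f j i k g = - f i j k g" for i j k g
    using form_on_X_swap[OF form, of g "[]" "frame10 a b c j" "frame10 a b c i" "[frame10 a b c k]"]
    by (simp add: f_def)
  have swap23: "f i k j g = - f i j k g" for i j k g
    using form_on_X_swap[OF form, of g "[frame10 a b c i]" "frame10 a b c k" "frame10 a b c j" "[]"]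
    by (simp add: f_def)
  have rep: "f i i k g = 0" "f i k k g = 0" for i k g
    using swap12[of i i k g] swap23[of i k k g] by simp_all
  have rep': "f i k i g = 0" for i k g
    using swap12[of k i i g] rep(2)[of k i g] by simp
  have dbar: "dir_deriv (frame01 a b c l) (f 1 2 3) g = 0" if l: "l \<in> {1,2,3}" for l g
  proof -
    have "length [1,2,3] = 3 \<and> set [1,2,3] \<subseteq> {1,2,3::nat} \<and> l \<in> {1,2,3}" using l by simp
    then have "dir_deriv (frame01 a b c l) (\<lambda>h. eval_form \<psi> h (map (frame10 a b c) [1,2,3])) g +
      (\<Sum>n<3. (-1)^n * (\<Sum>m\<in>{1,2,3}. conn a c m ([1,2,3]!n) l *
          eval_form \<psi> g (map (frame10 a b c) (m # rem n [1,2,3])))) = 0"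
      using \<psi> unfolding Hp0_iff by blast
    moreover have "(\<Sum>n<3::nat. F n) = F 0 + F 1 + F 2" for F :: "nat \<Rightarrow> complex"
      by (simp add: numeral_3_eq_3 numeral_2_eq_2)
    moreover have "rem 0 [1,2,3::nat] = [2,3]" "rem 1 [1,2,3::nat] = [1,3]" "rem 2 [1,2,3::nat] = [1,2]"
      by (simp_all add: rem_def)
    ultimately have "dir_deriv (frame01 a b c l) (f 1 2 3) g +
        ((conn a c 1 1 l * f 1 2 3 g + (conn a c 2 1 l * f 2 2 3 g + conn a c 3 1 l * f 3 2 3 g)) -
         (conn a c 1 2 l * f 1 1 3 g + (conn a c 2 2 l * f 2 1 3 g + conn a c 3 2 l * f 3 1 3 g)) +
         (conn a c 1 3 l * f 1 1 2 g + (conn a c 2 3 l * f 2 1 2 g + conn a c 3 3 l * f 3 1 2 g))) = 0"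
      unfolding sum_1_3 f_def by (simp add: algebra_simps)
    then show ?thesis using l by (auto simp: rep rep' conn_def)
  qed
  let ?q = "f 1 2 3 0"
  have f123: "f 1 2 3 g = ?q" for g
    by (rule dbar_zero_constant[OF inv dbar])
  have "\<psi> = (\<lambda>g L. ?q * phi123_form a b c g L)"
  proof (rule p0_form_eqI[OF a_nz c_nz p0 is_p0_scale[OF is_p0_phi123_form, of _ _ _ "\<lambda>_. ?q"]])
    show "\<And>g L. \<not> (length L = 3 \<and> set L \<subseteq> {1..6}) \<Longrightarrow> \<psi> g L = 0"
      by (rule form_on_XD(1)[OF form])
    show "?q * phi123_form a b c g L = 0" if "\<not> (length L = 3 \<and> set L \<subseteq> {1..6})" for g L
      using that unfolding phi123_form_def if_not_P[OF that] by simp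
  next
    fix g and K :: "nat list" assume "length K = 3" "set K \<subseteq> {1,2,3}"
    then obtain i j k where K: "K = [i, j, k]" and ijk: "i \<in> {1,2,3}" "j \<in> {1,2,3}" "k \<in> {1,2,3}"
      by (auto simp: numeral_3_eq_3 length_Suc_conv)
    have perms: "f 1 3 2 g = - ?q" "f 2 1 3 g = - ?q" "f 2 3 1 g = ?q" "f 3 1 2 g = ?q" "f 3 2 1 g = - ?q"
      using f123[of g] swap23[of 1 2 3 g] swap12[of 1 2 3 g] swap23[of 2 1 3 g]
        swap12[of 1 3 2 g] swap12[of 2 3 1 g] by simp_all
    have "f i j k g = ?q * det3 (\<lambda>r s. if Suc r = [i, j, k] ! s then 1 else 0)"
      using ijk
      by (elim insertE emptyE; simp only: perms f123[of g] rep rep') (simp_all add: det3_def)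
    then show "eval_form \<psi> g (map (frame10 a b c) K) =
        eval_form (\<lambda>g L. ?q * phi123_form a b c g L) g (map (frame10 a b c) K)"
      unfolding K list.map eval_form_scale[of "\<lambda>_. ?q"] eval_phi123_frame10[OF ijk] by (simp add: f_def)
  qed
  then show ?thesis by blast
qed

end

section \<open>Counting dimensions\<close>

lemma exp_half_eq_1_iff:
  "exp (\<i> * of_real (c / 2)) = 1 \<longleftrightarrow> c \<in> {4 * pi * of_int k | k. True}"
proof -
  have "exp (\<i> * of_real (c / 2)) = 1 \<longleftrightarrow> (\<exists>k::int. c / 2 = of_int (2 * k) * pi)"
    by (simp add: exp_eq_1)
  also have "\<dots> \<longleftrightarrow> (\<exists>k::int. c = 4 * pi * of_int k)"
    by (intro arg_cong[where f = Ex] ext) (auto simp: field_simps)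
  finally show ?thesis by simp
qed

lemma has_cdim_zero: "has_cdim {\<lambda>g L. 0} 0"
  unfolding has_cdim_def lin_comb_def by simp

lemma has_cdim_wave_forms:
  assumes "a \<noteq> 0" "c \<noteq> 0"
  shows "has_cdim {wave_form a b c A B |A B. True} 2"
  unfolding has_cdim_def
proof (intro exI conjI allI impI)
  let ?B = "\<lambda>i::nat. if i = 0 then wave_form a b c 1 0 else wave_form a b c 0 1"
  have lc: "lin_comb 2 q ?B = wave_form a b c (q 0) (q 1)" for q
    unfolding lin_comb_def wave_form_def by (simp add: numeral_2_eq_2 algebra_simps)
  show "{wave_form a b c A B |A B. True} = {lin_comb 2 q ?B |q. True}"
  proof -
    have "wave_form a b c A B = lin_comb 2 (\<lambda>i. if i = 0 then A else B) ?B" for A B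
      unfolding lc by simp
    then show ?thesis using lc by blast
  qed
  fix q i assume q: "lin_comb 2 q ?B = (\<lambda>g L. 0)" and i: "i < (2::nat)"
  then have z: "wave_form a b c (q 0) (q 1) 0 L = 0" for L unfolding lc by simp
  \<comment> \<open>Among the phi^k, e^3 occurs only in phi^2 and e^4 only in phi^3, so these two
    index pairs separate the wedge products. At the identity both waves equal 1.\<close>
  have w: "wedge2 a b c 1 2 0 [1,3] = of_real (a * c)" "wedge2 a b c 1 3 0 [1,3] = 0"
    "wedge2 a b c 1 2 0 [1,4] = 0" "wedge2 a b c 1 3 0 [1,4] = of_real (a * c)"
    by (simp_all add: wedge2_def phic_def)
  have "q 0 + q 1 = 0" using z[of "[1,3]"] assms unfolding wave_form_def w
    by (simp flip: distrib_right)
  moreover have "q 1 - q 0 = 0" using z[of "[1,4]"] assms unfolding wave_form_def w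
    by (simp add: algebra_simps flip: left_diff_distrib)
  ultimately have "q 0 = 0" "q 1 = 0" by (auto simp: add_eq_0_iff2)
  moreover have "i = 0 \<or> i = 1" using i by auto
  ultimately show "q i = 0" by auto
qed

theorem mainTheorem1:
  fixes a b c a0 :: real and B P :: "real^2^2"
  assumes "a \<noteq> 0" and "c \<noteq> 0"
    and "\<forall>i j. B$i$j \<in> \<int>" and "det B = 1"
    and "a0 > 0"
    and "invertible P"
    and "P ** B ** matrix_inv P = (\<chi> i j. if i = j then (if i = 1 then exp a0 else exp (- a0)) else 0)"
  shows "(has_cdim (Hp0 a0 P a b c 1) 1 \<and> Hp0 a0 P a b c 1 = {(\<lambda>g L. k * phi1_form a b c g L) | k. True})
    \<and> (c \<notin> {4 * pi * of_int k | k. True} \<longrightarrow> has_cdim (Hp0 a0 P a b c 2) 0)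
    \<and> (c \<in> {4 * pi * of_int k | k. True} \<longrightarrow> has_cdim (Hp0 a0 P a b c 2) 2)
    \<and> (has_cdim (Hp0 a0 P a b c 3) 1 \<and> Hp0 a0 P a b c 3 = {(\<lambda>g L. k * phi123_form a b c g L) | k. True})"
proof -
  note params = assms(1,2,5,6)
  have H1: "Hp0 a0 P a b c 1 = {(\<lambda>g L. k * phi1_form a b c g L) | k. True}"
    using Hp0_1_subset[OF params] phi1_form_in_Hp0[OF params] by blast
  have H3: "Hp0 a0 P a b c 3 = {(\<lambda>g L. k * phi123_form a b c g L) | k. True}"
    using Hp0_3_subset[OF params] phi123_form_in_Hp0[OF params] by blast
  \<comment> \<open>One description serves both cases: \<open>A\<close> and \<open>B\<close> are
    free if the exponential is 1, and otherwise only the zero form remains.\<close>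
  have H2: "Hp0 a0 P a b c 2 = {wave_form a b c A B |A B. A = 0 \<and> B = 0 \<or> exp (\<i> * of_real (c / 2)) = 1}"
    using Hp0_2_subset[OF params] wave_form_in_Hp0[OF params] by blast
  have "phi1_form a b c 0 [1] \<noteq> 0"
    using assms(1) by (simp add: phi1_form_def phic_def)
  then have "has_cdim (Hp0 a0 P a b c 1) 1" unfolding H1 by (rule has_cdim_line)
  moreover have "phi123_form a b c 0 [1,3,4] \<noteq> 0"
    using assms(1,2) by (simp add: phi123_form_def det3_def phic_def)
  then have "has_cdim (Hp0 a0 P a b c 3) 1" unfolding H3 by (rule has_cdim_line)
  moreover have "has_cdim (Hp0 a0 P a b c 2) 0" if "c \<notin> {4 * pi * of_int k | k. True}"
  proof -
    have "wave_form a b c 0 0 = (\<lambda>g L. 0)" by (simp add: wave_form_def)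
    then have "Hp0 a0 P a b c 2 = {\<lambda>g L. 0}"
      using that unfolding H2 exp_half_eq_1_iff by auto
    then show ?thesis by (simp only: has_cdim_zero)
  qed
  moreover have "has_cdim (Hp0 a0 P a b c 2) 2" if "c \<in> {4 * pi * of_int k | k. True}"
  proof -
    have "Hp0 a0 P a b c 2 = {wave_form a b c A B |A B. True}"
      using that unfolding H2 exp_half_eq_1_iff by auto
    then show ?thesis using has_cdim_wave_forms[OF assms(1,2)] by (simp only:)
  qed
  ultimately show ?thesis using H1 H3 by blast
qed

end
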